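(* Let $q$ be a prime power, let $d\ge 2$ and $1\le m\le d-1$ be integers, let $V$ be a $d$-dimensional vector space over $\mathbb{F}_q$, and let $\mathrm{PGL}_d(q)$ act on the set $\Omega$ of all $m$-dimensional subspaces of $V$. Then $$\mathrm{I}(\mathrm{PGL}_d(q),\Omega) \leq (m+1)d-2m+1,$$ and $$\mathrm{I}(\mathrm{PGL}_d(q),\Omega) \geq \begin{cases} md-m^2+1 & \text{if } q=2,\\ (m+1)d-m^2 & \text{if } q\neq 2.\end{cases}$$
   Context: For a group $G$ acting faithfully on a finite set $\Omega$, a base is a sequence $(\omega_1,\dots,\omega_l)$ of points of $\Omega$ with trivial pointwise stabilizer $G_{\omega_1,\dots,\omega_l}$. It is irredundant if $G > G_{\omega_1} > G_{\omega_1,\omega_2} > \cdots > G_{\omega_1,\dots,\omega_l}=1$ (all inclusions strict). $\mathrm{I}(G,\Omega)$ denotes the maximal length of an irredundant base. *)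

theory Defs
  imports
    Complex_Main
    "HOL-Library.Cardinality"
    "HOL-Number_Theory.Prime_Powers"
    "HOL-Algebra.Group_Action"
begin

section \<open>Bases of group actions\<close>

definition pointwise_stabilizer ::
  "('g, 'm) monoid_scheme \<Rightarrow> ('g \<Rightarrow> 'b \<Rightarrow> 'b) \<Rightarrow> 'b list \<Rightarrow> 'g set"
  where "pointwise_stabilizer G \<phi> xs = carrier G \<inter> (\<Inter>x\<in>set xs. stabilizer G \<phi> x)"

definition is_base ::
  "('g, 'm) monoid_scheme \<Rightarrow> 'b set \<Rightarrow> ('g \<Rightarrow> 'b \<Rightarrow> 'b) \<Rightarrow> 'b list \<Rightarrow> bool"
  where "is_base G \<Omega> \<phi> xs \<longleftrightarrow>
    set xs \<subseteq> \<Omega> \<and> pointwise_stabilizer G \<phi> xs = {\<one>\<^bsub>G\<^esub>}"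

definition irredundant_base ::
  "('g, 'm) monoid_scheme \<Rightarrow> 'b set \<Rightarrow> ('g \<Rightarrow> 'b \<Rightarrow> 'b) \<Rightarrow> 'b list \<Rightarrow> bool"
  where "irredundant_base G \<Omega> \<phi> xs \<longleftrightarrow>
    is_base G \<Omega> \<phi> xs \<and>
    (\<forall>i < length xs. pointwise_stabilizer G \<phi> (take (Suc i) xs)
                     \<subset> pointwise_stabilizer G \<phi> (take i xs))"

text \<open>For a finite group acting faithfully on a finite set, the set of lengths below is
  finite and nonempty; outside that situation the value is not meaningful.\<close>

definition max_irredundant ::
  "('g, 'm) monoid_scheme \<Rightarrow> 'b set \<Rightarrow> ('g \<Rightarrow> 'b \<Rightarrow> 'b) \<Rightarrow> nat"
  where "max_irredundant G \<Omega> \<phi> = Max (length ` {xs. irredundant_base G \<Omega> \<phi> xs})"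

section \<open>The projective general linear group acting on subspaces\<close>

text \<open>The vector space is the whole type \<open>'v\<close> with scalar multiplication \<open>s\<close>.\<close>

definition GL :: "('f::field \<Rightarrow> 'v::ab_group_add \<Rightarrow> 'v) \<Rightarrow> ('v \<Rightarrow> 'v) monoid"
  where "GL s = \<lparr>carrier = {f. Vector_Spaces.linear s s f \<and> bij f}, mult = (\<circ>), one = id\<rparr>"

definition scalars :: "('f::field \<Rightarrow> 'v::ab_group_add \<Rightarrow> 'v) \<Rightarrow> ('v \<Rightarrow> 'v) set"
  where "scalars s = s ` (UNIV - {0})"

definition PGL :: "('f::field \<Rightarrow> 'v::ab_group_add \<Rightarrow> 'v) \<Rightarrow> ('v \<Rightarrow> 'v) set monoid"
  where "PGL s = GL s Mod scalars s"

definition subspaces_of_dim :: "('f::field \<Rightarrow> 'v::ab_group_add \<Rightarrow> 'v) \<Rightarrow> nat \<Rightarrow> 'v set set"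
  where "subspaces_of_dim s m = {U. module.subspace s U \<and> vector_space.dim s U = m}"

text \<open>All representatives \<open>f\<close> of a coset \<open>C\<close> have the same image \<open>f ` U\<close> of a subspace \<open>U\<close>,
  so the union below is \<open>f ` U\<close> for any one of them (see \<open>PGL_action_coset\<close>).
  Library actions are extensional, hence the restriction to the domain.\<close>

definition PGL_action ::
  "('f::field \<Rightarrow> 'v::ab_group_add \<Rightarrow> 'v) \<Rightarrow> nat \<Rightarrow> ('v \<Rightarrow> 'v) set \<Rightarrow> 'v set \<Rightarrow> 'v set"
  where "PGL_action s m C = (\<lambda>U \<in> subspaces_of_dim s m. \<Union>f\<in>C. f ` U)"

lemma GL_mult [simp]: "f \<otimes>\<^bsub>GL s\<^esub> g = f \<circ> g"
  and GL_one [simp]: "\<one>\<^bsub>GL s\<^esub> = id"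
  by (simp_all add: GL_def)

lemma PGL_carrier: "carrier (PGL s) = (\<lambda>f. scalars s #>\<^bsub>GL s\<^esub> f) ` carrier (GL s)"
  by (simp add: PGL_def carrier_FactGroup)

lemma scalars_in_GL:
  assumes "vector_space s" "c \<noteq> 0"
  shows "s c \<in> carrier (GL s)"
proof -
  interpret vector_space s by fact
  have "Vector_Spaces.linear s s (s c)" by (rule linear_scale_self)
  moreover have "bij (s c)"
    by (rule bij_betw_byWitness[of _ "s (inverse c)"]) (use assms(2) in auto)
  ultimately show ?thesis by (simp add: GL_def)
qed

lemma group_GL:
  assumes "vector_space s"
  shows "group (GL s)"
proof (rule groupI)
  interpret vector_space s by fact
  show "\<And>f g. f \<in> carrier (GL s) \<Longrightarrow> g \<in> carrier (GL s) \<Longrightarrow> f \<otimes>\<^bsub>GL s\<^esub> g \<in> carrier (GL s)"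
    by (auto simp: GL_def intro: Vector_Spaces.linear_compose bij_comp)
  show "\<one>\<^bsub>GL s\<^esub> \<in> carrier (GL s)"
    by (simp add: GL_def linear_id[unfolded id_def] id_def bij_id[unfolded id_def])
  fix f assume f: "f \<in> carrier (GL s)"
  then interpret f: Vector_Spaces.linear s s f by (simp add: GL_def)
  from f have b: "bij f" by (simp add: GL_def)
  let ?g = "inv_into UNIV f"
  have g: "?g x = y \<longleftrightarrow> x = f y" for x y
    using bij_inv_eq_iff[OF b, of y x] by auto
  have "Vector_Spaces.linear s s (?g)"
  proof (unfold_locales)
    fix x y c
    show "?g (x + y) = ?g x + ?g y"
      by (metis g f.add)
    show "?g (s c x) = s c (?g x)"
      by (metis g f.scale)
  qed
  moreover have "?g \<circ> f = id" using g by (auto simp: fun_eq_iff)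
  ultimately show "\<exists>g\<in>carrier (GL s). g \<otimes>\<^bsub>GL s\<^esub> f = \<one>\<^bsub>GL s\<^esub>"
    using b bij_imp_bij_inv by (intro bexI[of _ ?g]) (auto simp: GL_def)
qed (auto simp: GL_def)

lemma normal_scalars:
  assumes "vector_space s"
  shows "scalars s \<lhd> GL s"
proof -
  interpret vector_space s by fact
  interpret G: group "GL s" by (rule group_GL[OF assms])
  have comm: "f \<otimes>\<^bsub>GL s\<^esub> s c = s c \<otimes>\<^bsub>GL s\<^esub> f" if "f \<in> carrier (GL s)" for f c
  proof -
    interpret f: Vector_Spaces.linear s s f using that by (simp add: GL_def)
    show ?thesis by (auto simp: GL_def fun_eq_iff f.scale)
  qed
  have inv: "inv\<^bsub>GL s\<^esub> (s c) = s (inverse c)" if "c \<noteq> 0" for c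
  proof (rule G.inv_equality)
    show "s (inverse c) \<otimes>\<^bsub>GL s\<^esub> s c = \<one>\<^bsub>GL s\<^esub>"
      using that by (simp add: GL_def fun_eq_iff)
  qed (simp_all add: that assms scalars_in_GL)
  have "subgroup (scalars s) (GL s)"
  proof (rule G.subgroupI)
    show "scalars s \<subseteq> carrier (GL s)" using scalars_in_GL[OF assms] by (auto simp: scalars_def)
    have "s 1 \<in> scalars s" by (simp add: scalars_def)
    then show "scalars s \<noteq> {}" by blast
    show "inv\<^bsub>GL s\<^esub> a \<in> scalars s" if "a \<in> scalars s" for a
      using that by (auto simp: scalars_def inv)
    show "a \<otimes>\<^bsub>GL s\<^esub> b \<in> scalars s" if ab: "a \<in> scalars s" "b \<in> scalars s" for a b
    proof -
      obtain c d where "a = s c" "b = s d" "c \<noteq> 0" "d \<noteq> 0" using ab by (auto simp: scalars_def)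
      then have "a \<otimes>\<^bsub>GL s\<^esub> b = s (c * d)" "c * d \<noteq> 0" by (auto simp: GL_def fun_eq_iff)
      then show ?thesis by (auto simp: scalars_def)
    qed
  qed
  moreover have "f \<otimes>\<^bsub>GL s\<^esub> h \<otimes>\<^bsub>GL s\<^esub> inv\<^bsub>GL s\<^esub> f \<in> scalars s"
    if f: "f \<in> carrier (GL s)" and h: "h \<in> scalars s" for f h
  proof -
    obtain c where c: "h = s c" "c \<noteq> 0" using h by (auto simp: scalars_def)
    have "f \<otimes>\<^bsub>GL s\<^esub> h \<otimes>\<^bsub>GL s\<^esub> inv\<^bsub>GL s\<^esub> f = h"
      unfolding c(1) comm[OF f]
      using f scalars_in_GL[OF assms c(2)] by (simp add: G.m_assoc del: GL_mult GL_one)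
    then show ?thesis using h by simp
  qed
  ultimately show ?thesis
    unfolding G.normal_inv_iff by blast
qed

lemma group_PGL: "vector_space s \<Longrightarrow> group (PGL s)"
  unfolding PGL_def by (intro normal.factorgroup_is_group normal_scalars)

lemma PGL_action_coset:
  assumes "vector_space s" "U \<in> subspaces_of_dim s m" "f \<in> carrier (GL s)"
  shows "PGL_action s m (scalars s #>\<^bsub>GL s\<^esub> f) U = f ` U"
proof -
  interpret vector_space s by fact
  interpret f: Vector_Spaces.linear s s f using assms(3) by (simp add: GL_def)
  have U: "subspace U" using assms(2) by (simp add: subspaces_of_dim_def)
  have "(\<Union>g\<in>scalars s #>\<^bsub>GL s\<^esub> f. g ` U) = (\<Union>c\<in>UNIV - {0}. (\<lambda>u. s c (f u)) ` U)"
    by (auto simp: r_coset_def scalars_def GL_def)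
  also have "\<dots> = f ` U"
  proof
    show "(\<Union>c\<in>UNIV - {0}. (\<lambda>u. s c (f u)) ` U) \<subseteq> f ` U"
      using U by (auto simp flip: f.scale intro!: imageI subspace_scale)
    show "f ` U \<subseteq> (\<Union>c\<in>UNIV - {0}. (\<lambda>u. s c (f u)) ` U)"
      by (intro subsetI UN_I[of 1]) auto
  qed
  finally show ?thesis using assms(2) by (simp add: PGL_action_def)
qed

lemma GL_image_subspaces_of_dim:
  assumes "vector_space s" "U \<in> subspaces_of_dim s m" "f \<in> carrier (GL s)"
  shows "f ` U \<in> subspaces_of_dim s m"
proof -
  interpret vector_space s by fact
  interpret vector_space_pair s s ..
  have f: "Vector_Spaces.linear s s f" "inj f" using assms(3) by (auto simp: GL_def bij_is_inj)
  interpret f: Vector_Spaces.linear s s f by (rule f(1))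
  have U: "subspace U" "dim U = m" using assms(2) by (auto simp: subspaces_of_dim_def)
  obtain B where B: "B \<subseteq> U" "independent B" "U \<subseteq> span B" "card B = dim U"
    using basis_exists by blast
  have sp: "span B = U" using B U by (metis span_minimal subset_antisym)
  have i: "inj_on f (span B)" using f(2) by (rule inj_on_subset) simp
  have "independent (f ` B)"
    using f.independent_injective_image[OF B(2) i] .
  moreover have "span (f ` B) = f ` U" using sp by (simp add: f.span_image)
  ultimately have "dim (f ` U) = card (f ` B)" by (metis dim_eq_card span_span)
  also have "\<dots> = m" using B U f(2) by (metis card_image inj_on_subset subset_UNIV)
  finally show ?thesis using U f.subspace_image by (auto simp: subspaces_of_dim_def)
qed

lemma group_action_PGL:
  assumes vs: "vector_space s"
  shows "group_action (PGL s) (subspaces_of_dim s m) (PGL_action s m)"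
proof -
  interpret N: normal "scalars s" "GL s" by (rule normal_scalars[OF vs])
  let ?O = "subspaces_of_dim s m"
  have Bij: "PGL_action s m C \<in> Bij ?O" if C: "C \<in> carrier (PGL s)" for C
  proof -
    obtain f where f: "f \<in> carrier (GL s)" "C = scalars s #>\<^bsub>GL s\<^esub> f"
      using C by (auto simp: PGL_carrier)
    let ?g = "inv\<^bsub>GL s\<^esub> f"
    have g: "?g \<in> carrier (GL s)" using f by simp
    have "f \<circ> ?g = id" "?g \<circ> f = id"
      using N.r_inv[OF f(1)] N.l_inv[OF f(1)] by simp_all
    then have "f (?g v) = v" "?g (f v) = v" for v by (simp_all add: fun_eq_iff)
    then have im: "f ` ?g ` U = U" "?g ` f ` U = U" for U by (simp_all add: image_image)
    have "bij_betw (\<lambda>U. f ` U) ?O ?O"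
      by (rule bij_betw_byWitness[of _ "\<lambda>U. ?g ` U"])
         (use im GL_image_subspaces_of_dim[OF vs _ f(1)] GL_image_subspaces_of_dim[OF vs _ g] in auto)
    moreover have "PGL_action s m C U = f ` U" if "U \<in> ?O" for U
      using PGL_action_coset[OF vs that f(1)] f(2) by simp
    ultimately have "bij_betw (PGL_action s m C) ?O ?O"
      by (simp cong: bij_betw_cong)
    then show ?thesis by (simp add: Bij_def PGL_action_def)
  qed
  have "PGL_action s m (C \<otimes>\<^bsub>PGL s\<^esub> D) = compose ?O (PGL_action s m C) (PGL_action s m D)"
    if CD: "C \<in> carrier (PGL s)" "D \<in> carrier (PGL s)" for C D
  proof -
    obtain f g where fg: "f \<in> carrier (GL s)" "C = scalars s #>\<^bsub>GL s\<^esub> f"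
        "g \<in> carrier (GL s)" "D = scalars s #>\<^bsub>GL s\<^esub> g"
      using CD by (auto simp: PGL_carrier)
    have "C \<otimes>\<^bsub>PGL s\<^esub> D = scalars s #>\<^bsub>GL s\<^esub> (f \<otimes>\<^bsub>GL s\<^esub> g)"
      using fg by (simp add: PGL_def N.rcos_sum del: GL_mult)
    then have "PGL_action s m (C \<otimes>\<^bsub>PGL s\<^esub> D) U = PGL_action s m C (PGL_action s m D U)"
      if "U \<in> ?O" for U
      using that fg N.m_closed[OF fg(1,3)]
      by (simp add: PGL_action_coset vs GL_image_subspaces_of_dim image_comp)
    then show ?thesis by (auto simp: compose_def PGL_action_def fun_eq_iff)
  qed
  then have "PGL_action s m \<in> hom (PGL s) (BijGroup ?O)"
    by (intro homI) (auto simp: BijGroup_def Bij)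
  then show ?thesis
    by (intro group_action.intro group_hom.intro group_hom_axioms.intro
        group_PGL vs group_BijGroup)
qed

end

theory Submission
  imports Defs
begin

text \<open>
  Write \<open>d\<close> for the dimension of the space, \<open>q\<close> for the order of the field, and
  let \<open>U\<^sub>1, \<dots>, U\<^sub>l\<close> be \<open>m\<close>-subspaces along which the stabilizers strictly decrease.

  \<^bold>\<open>Upper bound.\<close> Linearise: replace the stabilizer of the first \<open>k\<close> subspaces by the
  algebra \<open>A\<^sub>k\<close> of all endomorphisms that map each of them into itself. A stabilizing
  element of the group that moves \<open>U\<close> is a map in \<open>A\<^sub>k\<close> that does not preserve \<open>U\<close>, so
  the algebras decrease strictly as well, and their dimensions can be compared with
  \<open>w\<^sub>k = dim (U\<^sub>1 + \<dots> + U\<^sub>k)\<close>. If \<open>U\<^sub>k\<^sub>+\<^sub>1\<close> lies in the previous sum, the dimension of the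
  algebra drops by at least 1. If it enlarges the sum by \<open>e > 0\<close> dimensions, the drop is
  at least \<open>e (d - m)\<close>, because a map that kills the previous sum is free to send \<open>e\<close>
  independent vectors of \<open>U\<^sub>k\<^sub>+\<^sub>1\<close> anywhere in a complement of \<open>U\<^sub>k\<^sub>+\<^sub>1\<close>. Hence
  \<open>k + dim A\<^sub>k - (m + 1) w\<^sub>k - d (d - w\<^sub>k)\<close> never increases. It is at most \<open>2 - 2m\<close> for
  \<open>k = 2\<close>: there the drop is larger by \<open>e (m - e)\<close>, since maps need only preserve
  \<open>U\<^sub>1\<close>, not kill it. At the end \<open>A\<^sub>l\<close> contains the maps that are scalar on the sum
  and arbitrary on a complement, which makes its dimension at least \<open>1 + d (d - w\<^sub>l)\<close>;
  this gives \<open>l \<le> (m + 1) w\<^sub>l - 2m + 1\<close>. Dimensions of algebras are measured by the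
  logarithm to base \<open>q\<close> of their cardinalities. The carrying lemmas are
  \<open>card_preserving_insert\<close> and its two consequences, \<open>irredundant_chain_card_bound\<close>,
  and \<open>irredundant_chain_length_le\<close>.

  \<^bold>\<open>Lower bound.\<close> Fix a basis and an \<open>m\<close>-subset \<open>M\<close> of it. Start with the span of
  \<open>M\<close> and adjoin, for all \<open>a \<in> M\<close> and \<open>b \<notin> M\<close>, the span of \<open>M - {a} \<union> {b}\<close>.
  The transvection \<open>b \<mapsto> a + b\<close> fixes all of these except the one belonging to
  \<open>(a, b)\<close>, so the \<open>m (d - m) + 1\<close> subspaces can be taken in any order after the first.
  All of them are coordinate subspaces, hence fixed by the diagonal maps. If the field
  has a scalar \<open>c\<close> other than 0 and 1, then \<open>d - 1\<close> further subspaces, each spanned by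
  \<open>e + i\<close> and \<open>m - 1\<close> other basis vectors for a fixed basis vector \<open>e\<close> and a varying
  basis vector \<open>i \<noteq> e\<close>, can be adjoined: multiplying \<open>i\<close> by \<open>c\<close> moves only the one
  belonging to \<open>i\<close>. Finally, only scalar maps fix every \<open>m\<close>-subspace, so each such
  sequence extends to an irredundant base.
\<close>

section \<open>Irredundant chains of stabilizers\<close>

definition irredundant_chain ::
  "('g, 'm) monoid_scheme \<Rightarrow> ('g \<Rightarrow> 'b \<Rightarrow> 'b) \<Rightarrow> 'b list \<Rightarrow> bool"
  where "irredundant_chain G \<phi> xs \<longleftrightarrow>
    (\<forall>i < length xs. pointwise_stabilizer G \<phi> (take (Suc i) xs)
                     \<subset> pointwise_stabilizer G \<phi> (take i xs))"

lemma irredundant_base_iff: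
  "irredundant_base G \<Omega> \<phi> xs \<longleftrightarrow> is_base G \<Omega> \<phi> xs \<and> irredundant_chain G \<phi> xs"
  by (simp add: irredundant_base_def irredundant_chain_def)

lemma mem_pointwise_stabilizer:
  "g \<in> pointwise_stabilizer G \<phi> xs \<longleftrightarrow> g \<in> carrier G \<and> (\<forall>x\<in>set xs. \<phi> g x = x)"
  by (auto simp: pointwise_stabilizer_def stabilizer_def)

lemma irredundant_chain_Nil [simp]: "irredundant_chain G \<phi> []"
  by (simp add: irredundant_chain_def)

lemma irredundant_chain_snoc:
  "irredundant_chain G \<phi> (xs @ [x]) \<longleftrightarrow>
    irredundant_chain G \<phi> xs \<and> (\<exists>g\<in>pointwise_stabilizer G \<phi> xs. \<phi> g x \<noteq> x)"
proof -
  have "pointwise_stabilizer G \<phi> (xs @ [x]) \<subset> pointwise_stabilizer G \<phi> xs \<longleftrightarrow>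
      (\<exists>g\<in>pointwise_stabilizer G \<phi> xs. \<phi> g x \<noteq> x)"
    by (auto simp: psubset_eq set_eq_iff subset_iff mem_pointwise_stabilizer)
  then show ?thesis
    by (auto simp: irredundant_chain_def less_Suc_eq)
qed

text \<open>Points that are moved one at a time, each by a group element fixing all the others,
  may be appended in any order. The family is indexed because its injectivity then comes
  for free.\<close>

lemma irredundant_chain_append_independent:
  assumes "irredundant_chain G \<phi> xs" "distinct is"
    and "\<And>i. i \<in> set is \<Longrightarrow> \<exists>g\<in>pointwise_stabilizer G \<phi> xs.
      (\<forall>j\<in>set is - {i}. \<phi> g (y j) = y j) \<and> \<phi> g (y i) \<noteq> y i"
  shows "irredundant_chain G \<phi> (xs @ map y is)"
  using assms
proof (induction "is" rule: rev_induct)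
  case (snoc i "is")
  have "irredundant_chain G \<phi> (xs @ map y is)"
  proof (rule snoc.IH)
    fix j assume j: "j \<in> set is"
    then have "j \<noteq> i" using snoc.prems(2) by auto
    then show "\<exists>g\<in>pointwise_stabilizer G \<phi> xs.
      (\<forall>k\<in>set is - {j}. \<phi> g (y k) = y k) \<and> \<phi> g (y j) \<noteq> y j"
      using snoc.prems(3)[of j] j by auto
  qed (use snoc.prems in auto)
  moreover obtain g where "g \<in> pointwise_stabilizer G \<phi> xs"
      "\<forall>j\<in>set (is @ [i]) - {i}. \<phi> g (y j) = y j" "\<phi> g (y i) \<noteq> y i"
    using snoc.prems(3)[of i] by auto
  then have "g \<in> pointwise_stabilizer G \<phi> (xs @ map y is) \<and> \<phi> g (y i) \<noteq> y i"
    using snoc.prems(2) by (auto simp: mem_pointwise_stabilizer)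
  ultimately show ?case
    using irredundant_chain_snoc[of G \<phi> "xs @ map y is" "y i"] by auto
qed simp

text \<open>Going through \<open>zs\<close> and keeping only the points that shrink the stabilizer turns any
  extension into an irredundant one with the same stabilizer.\<close>

lemma irredundant_chain_extend:
  assumes "irredundant_chain G \<phi> xs"
  obtains ys where "set ys \<subseteq> set zs" "irredundant_chain G \<phi> (xs @ ys)"
    "pointwise_stabilizer G \<phi> (xs @ ys) = pointwise_stabilizer G \<phi> (xs @ zs)"
proof -
  have "\<exists>ys. set ys \<subseteq> set zs \<and> irredundant_chain G \<phi> (xs @ ys) \<and>
    pointwise_stabilizer G \<phi> (xs @ ys) = pointwise_stabilizer G \<phi> (xs @ zs)"
  proof (induction zs rule: rev_induct)
    case Nil
    then show ?case using assms by auto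
  next
    case (snoc z zs)
    then obtain ys where ys: "set ys \<subseteq> set zs" "irredundant_chain G \<phi> (xs @ ys)"
      "pointwise_stabilizer G \<phi> (xs @ ys) = pointwise_stabilizer G \<phi> (xs @ zs)" by blast
    have eq: "pointwise_stabilizer G \<phi> (xs @ ys @ [z]) = pointwise_stabilizer G \<phi> (xs @ zs @ [z])"
      using ys(3) by (auto simp: set_eq_iff mem_pointwise_stabilizer)
    show ?case
    proof (cases "\<exists>g\<in>pointwise_stabilizer G \<phi> (xs @ ys). \<phi> g z \<noteq> z")
      case True
      then have "irredundant_chain G \<phi> (xs @ ys @ [z])"
        using ys(2) irredundant_chain_snoc[of G \<phi> "xs @ ys" z] by simp
      then show ?thesis using ys(1) eq by (intro exI[of _ "ys @ [z]"]) auto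
    next
      case False
      then have "pointwise_stabilizer G \<phi> (xs @ ys @ [z]) = pointwise_stabilizer G \<phi> (xs @ ys)"
        by (auto simp: set_eq_iff mem_pointwise_stabilizer)
      then show ?thesis using ys eq by (intro exI[of _ ys]) auto
    qed
  qed
  then show ?thesis using that by blast
qed

section \<open>Linear algebra over a finite field\<close>

locale finite_vector_space = finite_dimensional_vector_space scale Basis
  for scale :: "'f::{field, finite} \<Rightarrow> 'v::ab_group_add \<Rightarrow> 'v" (infixr \<open>*s\<close> 75)
    and Basis :: "'v set"
begin

interpretation endo: vector_space_pair scale scale ..

lemma card_span:
  assumes B: "independent B"
  shows "card (span B) = CARD('f) ^ card B"
    and finite_span: "finite (span B)"
proof -
  have fin: "finite B" by (rule finiteI_independent[OF B])
  let ?c = "\<lambda>u. \<Sum>b\<in>B. u b *s b"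
  have "inj_on ?c (B \<rightarrow>\<^sub>E UNIV)"
  proof (rule inj_onI, rule PiE_ext)
    fix u v b
    assume eq: "?c u = ?c v" and b: "b \<in> B"
    have "(\<Sum>b\<in>B. (u b - v b) *s b) = 0"
      using eq by (simp add: scale_left_diff_distrib sum_subtractf)
    then show "u b = v b"
      using independentD[OF B fin subset_refl, of "\<lambda>b. u b - v b" b] b by simp
  qed
  moreover have "?c ` (B \<rightarrow>\<^sub>E UNIV) = span B"
  proof -
    have "?c u \<in> ?c ` (B \<rightarrow>\<^sub>E UNIV)" for u
      by (rule image_eqI[of _ _ "restrict u B"]) auto
    then show ?thesis unfolding span_finite[OF fin] by blast
  qed
  ultimately have "bij_betw ?c (B \<rightarrow>\<^sub>E UNIV) (span B)" by (simp add: bij_betw_def)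
  from bij_betw_same_card[OF this] bij_betw_finite[OF this] fin
  show "card (span B) = CARD('f) ^ card B" "finite (span B)"
    by (simp_all add: card_PiE finite_PiE)
qed

lemma two_le_card_field: "2 \<le> CARD('f)"
proof -
  have "card {0, 1 :: 'f} \<le> CARD('f)" by (rule card_mono) auto
  then show ?thesis by simp
qed

lemma finite_vectors [simp]: "finite (A :: 'v set)"
proof -
  have "finite (UNIV :: 'v set)" using finite_span[OF independent_Basis] by (simp only: span_Basis)
  then show ?thesis by (rule rev_finite_subset) simp
qed

lemma finite_endofunctions [simp]: "finite (A :: ('v \<Rightarrow> 'v) set)"
proof -
  have "finite (UNIV \<rightarrow>\<^sub>E UNIV :: ('v \<Rightarrow> 'v) set)" by (intro finite_PiE) auto
  moreover have "A \<subseteq> UNIV \<rightarrow>\<^sub>E UNIV" by auto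
  ultimately show ?thesis by (rule rev_finite_subset)
qed

lemma span_Int_disjoint:
  assumes "independent (S \<union> T)" "S \<inter> T = {}"
  shows "span S \<inter> span T = {0}"
proof -
  have "independent S" "independent T" by (rule independent_mono[OF assms(1)], simp)+
  then have "card (S \<union> T) + dim (span S \<inter> span T) = card S + card T"
    using dim_sums_Int[of "span S" "span T"] assms(1)
    by (simp add: span_Un[symmetric] dim_eq_card_independent)
  moreover have "card (S \<union> T) = card S + card T"
    using assms by (intro card_Un_disjoint) auto
  ultimately have "span S \<inter> span T \<subseteq> {0}" by simp
  then show ?thesis by (auto simp: span_zero)
qed

text \<open>A basis of the whole space compatible with two subspaces: \<open>X\<close> is a basis of their
  intersection, \<open>E\<close> and \<open>Z\<close> complete it to bases of \<open>U\<close> and \<open>W\<close>, and \<open>R\<close> is the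
  rest, so that \<open>Z \<union> R\<close> spans a complement of \<open>U\<close>.\<close>

lemma adapted_basis:
  assumes U: "subspace U" and W: "subspace W"
  obtains X E Z R where
    "independent (X \<union> E \<union> Z \<union> R)" "span (X \<union> E \<union> Z \<union> R) = UNIV"
    "X \<inter> E = {}" "(X \<union> E) \<inter> Z = {}" "(X \<union> E \<union> Z) \<inter> R = {}"
    "span X = U \<inter> W" "span (X \<union> E) = U" "span (X \<union> Z) = W"
    "span (Z \<union> R) \<inter> U = {0}"
    "dim (U \<inter> W) = card X" "dim U = card X + card E" "dim W = card X + card Z"
    "dimension = card X + card E + card (Z \<union> R)"
proof -
  have UW: "subspace (U \<inter> W)" using U W by (rule subspace_inter)
  obtain X where X: "X \<subseteq> U \<inter> W" "independent X" "U \<inter> W \<subseteq> span X"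
    by (rule basis_exists[of "U \<inter> W"])
  obtain P where P: "X \<subseteq> P" "P \<subseteq> U" "independent P" "U \<subseteq> span P"
    using maximal_independent_subset_extend[of X U] X by blast
  obtain Q where Q: "X \<subseteq> Q" "Q \<subseteq> W" "independent Q" "W \<subseteq> span Q"
    using maximal_independent_subset_extend[of X W] X by blast
  have sp: "span X = U \<inter> W" "span P = U" "span Q = W"
    by (rule span_subspace[OF X(1,3) UW], rule span_subspace[OF P(2,4) U], rule span_subspace[OF Q(2,4) W])
  have "P \<inter> Q = X"
  proof
    show "P \<inter> Q \<subseteq> X"
    proof (rule subsetI, rule ccontr)
      fix x assume x: "x \<in> P \<inter> Q" "x \<notin> X"
      then have "x \<in> span X" using P Q sp by blast
      then have "x \<in> span (P - {x})" using x P span_mono[of X "P - {x}"] by blast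
      then show False using P(3) x dependent_def by blast
    qed
  qed (use P Q in auto)
  then have "card (P \<union> Q) + card X = card P + card Q"
    by (simp add: card_Un_Int[of P Q])
  moreover have "dim (span (P \<union> Q)) + card X = card P + card Q"
    using dim_sums_Int[OF U W] dim_span_eq_card_independent[OF X(2)]
      dim_span_eq_card_independent[OF P(3)] dim_span_eq_card_independent[OF Q(3)]
    unfolding span_Un sp by simp
  ultimately have "card (P \<union> Q) \<le> dim (span (P \<union> Q))" by simp
  then have "independent (P \<union> Q)"
    by (rule card_le_dim_spanning[rotated 3]) (auto simp: span_superset)
  then obtain B where B: "P \<union> Q \<subseteq> B" "B \<subseteq> UNIV" "independent B" "UNIV \<subseteq> span B"
    by (rule maximal_independent_subset_extend[OF subset_UNIV])
  have spB: "span B = UNIV" using B(4) by (rule top.extremum_uniqueI)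
  let ?E = "P - X" and ?Z = "Q - X" and ?R = "B - (P \<union> Q)"
  have eqs: "X \<union> ?E = P" "X \<union> ?Z = Q" "P \<union> (?Z \<union> ?R) = B"
    and disj: "X \<inter> ?E = {}" "X \<inter> ?Z = {}" "P \<inter> (?Z \<union> ?R) = {}"
    using P(1) Q(1) B(1) \<open>P \<inter> Q = X\<close> by auto
  have "independent (P \<union> (?Z \<union> ?R))" unfolding eqs by (rule B(3))
  then have "span P \<inter> span (?Z \<union> ?R) = {0}" by (rule span_Int_disjoint) fact
  moreover have "card P = card X + card ?E" "card Q = card X + card ?Z"
    "card B = card P + card (?Z \<union> ?R)"
    using card_Un_disjoint[OF _ _ disj(1)] card_Un_disjoint[OF _ _ disj(2)]
      card_Un_disjoint[OF _ _ disj(3)] by (simp_all only: eqs finite_vectors)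
  moreover have "X \<union> ?E \<union> ?Z \<union> ?R = B" "(X \<union> ?E) \<inter> ?Z = {}" "(X \<union> ?E \<union> ?Z) \<inter> ?R = {}"
    using P(1) Q(1) B(1) \<open>P \<inter> Q = X\<close> by auto
  moreover have "dim (U \<inter> W) = card X" "dim U = card P" "dim W = card Q" "dimension = card B"
    using dim_span_eq_card_independent[OF X(2)] dim_span_eq_card_independent[OF P(3)]
      dim_span_eq_card_independent[OF Q(3)] dim_span_eq_card_independent[OF B(3)]
    by (simp_all add: sp spB dimension_def)
  ultimately show ?thesis
    by (intro that[of X ?E ?Z ?R]) (simp_all add: eqs disj sp spB B(3) Int_commute del: Un_Diff_cancel)
qed

section \<open>Algebras of maps preserving given subspaces\<close>

definition preserving :: "'v set set \<Rightarrow> ('v \<Rightarrow> 'v) set"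
  where "preserving \<U> = {f. Vector_Spaces.linear scale scale f \<and> (\<forall>U\<in>\<U>. f ` U \<subseteq> U)}"

text \<open>The counting principle behind every codimension estimate below. The maps sending each
  basis vector \<open>b\<close> into \<open>F b\<close> form a subspace of the algebra preserving \<open>\<U>\<close>. Such a
  map that also preserves \<open>U\<close> sends each basis vector in \<open>U\<close> to a point of
  \<open>F b \<inter> U = {0}\<close>; as it kills the other basis vectors anyway, it is zero. So the subspace meets the smaller algebra
  trivially, and sums of elements of the two are pairwise distinct.\<close>

lemma card_preserving_insert:
  assumes B: "independent B" "span B = UNIV" and U: "subspace U"
    and F: "\<And>b. b \<in> B \<Longrightarrow> subspace (F b)"
    and F_off: "\<And>b. b \<in> B - U \<Longrightarrow> F b = {0}"
    and F_on: "\<And>b. b \<in> B \<inter> U \<Longrightarrow> F b \<inter> U = {0}"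
    and \<U>: "\<And>T. T \<in> \<U> \<Longrightarrow> subspace T"
    and F_pres: "\<And>f T. Vector_Spaces.linear scale scale f \<Longrightarrow> (\<And>b. b \<in> B \<Longrightarrow> f b \<in> F b) \<Longrightarrow>
      T \<in> \<U> \<Longrightarrow> f ` T \<subseteq> T"
  shows "card (preserving (insert U \<U>)) * (\<Prod>b\<in>B. card (F b)) \<le> card (preserving \<U>)"
proof -
  let ?c = "endo.construct B"
  have lin: "Vector_Spaces.linear scale scale (?c g)" for g by (rule endo.linear_construct[OF B(1)])
  have val: "?c g b = g b" if "b \<in> B" for g b by (rule endo.construct_basis[OF B(1) that])
  let ?h = "\<lambda>(f, g). \<lambda>v. f v + ?c g v"
  let ?D = "preserving (insert U \<U>) \<times> (\<Pi>\<^sub>E b\<in>B. F b)"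
  have "inj_on ?h ?D"
  proof (rule inj_onI, safe)
    fix f g f' g'
    assume f: "f \<in> preserving (insert U \<U>)" and f': "f' \<in> preserving (insert U \<U>)"
      and g: "g \<in> (\<Pi>\<^sub>E b\<in>B. F b)" and g': "g' \<in> (\<Pi>\<^sub>E b\<in>B. F b)"
      and eq: "(\<lambda>v. f v + ?c g v) = (\<lambda>v. f' v + ?c g' v)"
    show gg: "g = g'"
    proof (rule PiE_ext[OF g g'])
      fix b assume b: "b \<in> B"
      then have gb: "g b \<in> F b" "g' b \<in> F b" using g g' by auto
      show "g b = g' b"
      proof (cases "b \<in> U")
        case True
        have "f b + g b = f' b + g' b" using fun_cong[OF eq, of b] val[OF b] by simp
        then have "g b - g' b = f' b - f b" by (simp add: algebra_simps)
        moreover have "f' b - f b \<in> U"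
          using f f' True U by (auto simp: preserving_def intro!: subspace_diff)
        ultimately have "g b - g' b \<in> F b \<inter> U"
          using subspace_diff[OF F[OF b] gb] by simp
        then show ?thesis using F_on[of b] b True by simp
      qed (use gb F_off b in auto)
    qed
    show "f = f'" using eq gg by (simp add: fun_eq_iff)
  qed
  moreover have "?h ` ?D \<subseteq> preserving \<U>"
  proof (safe)
    fix f g
    assume f: "f \<in> preserving (insert U \<U>)" and g: "g \<in> (\<Pi>\<^sub>E b\<in>B. F b)"
    have "?c g ` T \<subseteq> T" if "T \<in> \<U>" for T
      by (rule F_pres[OF lin _ that]) (use g val in auto)
    then have "(\<lambda>v. f v + ?c g v) ` T \<subseteq> T" if "T \<in> \<U>" for T
      using f that by (auto simp: preserving_def image_subset_iff intro!: subspace_add[OF \<U>[OF that]])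
    moreover have "Vector_Spaces.linear scale scale (\<lambda>v. f v + ?c g v)"
      using f by (intro endo.linear_compose_add lin) (simp add: preserving_def)
    ultimately show "(\<lambda>v. f v + ?c g v) \<in> preserving \<U>" by (simp add: preserving_def)
  qed
  ultimately have "card ?D \<le> card (preserving \<U>)" by (intro card_inj_on_le) auto
  then show ?thesis by (simp add: card_cartesian_product card_PiE)
qed

text \<open>Maps that kill \<open>W\<close> preserve every subspace of \<open>W\<close>, so the vectors \<open>E\<close> that
  complete \<open>U \<inter> W\<close> to \<open>U\<close> may be sent anywhere in a complement of \<open>U\<close>.\<close>

lemma card_preserving_insert_transversal:
  assumes U: "subspace U" and W: "subspace W"
    and \<U>: "\<And>T. T \<in> \<U> \<Longrightarrow> subspace T" "\<And>T. T \<in> \<U> \<Longrightarrow> T \<subseteq> W"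
  shows "card (preserving (insert U \<U>))
      * CARD('f) ^ ((dim U - dim (U \<inter> W)) * (dimension - dim U)) \<le> card (preserving \<U>)"
proof -
  obtain X E Z R where
    B: "independent (X \<union> E \<union> Z \<union> R)" "span (X \<union> E \<union> Z \<union> R) = UNIV"
    and disj: "X \<inter> E = {}" "(X \<union> E) \<inter> Z = {}" "(X \<union> E \<union> Z) \<inter> R = {}"
    and sp: "span X = U \<inter> W" "span (X \<union> E) = U" "span (X \<union> Z) = W"
    and compl: "span (Z \<union> R) \<inter> U = {0}"
    and dims: "dim (U \<inter> W) = card X" "dim U = card X + card E" "dim W = card X + card Z"
      "dimension = card X + card E + card (Z \<union> R)"
    by (rule adapted_basis[OF U W])
  let ?B = "X \<union> E \<union> Z \<union> R"
  let ?F = "\<lambda>b. if b \<in> E then span (Z \<union> R) else {0}"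
  have ind: "independent A" if "A \<subseteq> ?B" for A using B(1) that by (rule independent_mono)
  have "card (preserving (insert U \<U>)) * (\<Prod>b\<in>?B. card (?F b)) \<le> card (preserving \<U>)"
  proof (rule card_preserving_insert[OF B U])
    fix b assume "b \<in> ?B - U"
    moreover have "E \<subseteq> U" using sp(2) span_superset by blast
    ultimately show "?F b = {0}" by auto
  next
    fix f T assume f: "Vector_Spaces.linear scale scale f" "\<And>b. b \<in> ?B \<Longrightarrow> f b \<in> ?F b"
      and T: "T \<in> \<U>"
    interpret f: Vector_Spaces.linear scale scale f by (rule f(1))
    have "f b = 0" if "b \<in> X \<union> Z" for b using f(2)[of b] that disj by (auto split: if_splits)
    then have "f x = 0" if "x \<in> W" for x using f.eq_0_on_span[of "X \<union> Z" x] that sp(3) by blast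
    then show "f ` T \<subseteq> T" using \<U>[OF T] subspace_0[of T] by auto
  qed (use compl U \<U> subspace_0 in auto)
  moreover have "(\<Prod>b\<in>?B. card (?F b)) = (\<Prod>b\<in>E. card (span (Z \<union> R)))"
    by (rule prod.mono_neutral_cong_right) auto
  moreover have "\<dots> = CARD('f) ^ ((dim U - dim (U \<inter> W)) * (dimension - dim U))"
    using card_span(1)[OF ind[of "Z \<union> R"]] dims
    by (simp add: power_mult[symmetric] mult.commute le_supI1 le_supI2)
  ultimately show ?thesis by simp
qed

text \<open>If \<open>W\<close> itself is the only subspace to be preserved, there is additional freedom:
  vectors of \<open>U \<inter> W\<close> may be moved into a complement of \<open>U \<inter> W\<close> in \<open>W\<close>. This extra
  term is what lowers the final bound from \<open>(m + 1) d - m\<close> to \<open>(m + 1) d - 2m + 1\<close>.\<close>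

lemma card_preserving_pair:
  assumes U: "subspace U" and W: "subspace W"
  shows "card (preserving {U, W})
      * CARD('f) ^ ((dim U - dim (U \<inter> W)) * (dimension - dim U)
                  + dim (U \<inter> W) * (dim W - dim (U \<inter> W))) \<le> card (preserving {W})"
proof -
  obtain X E Z R where
    B: "independent (X \<union> E \<union> Z \<union> R)" "span (X \<union> E \<union> Z \<union> R) = UNIV"
    and disj: "X \<inter> E = {}" "(X \<union> E) \<inter> Z = {}" "(X \<union> E \<union> Z) \<inter> R = {}"
    and sp: "span X = U \<inter> W" "span (X \<union> E) = U" "span (X \<union> Z) = W"
    and compl: "span (Z \<union> R) \<inter> U = {0}"
    and dims: "dim (U \<inter> W) = card X" "dim U = card X + card E" "dim W = card X + card Z"
      "dimension = card X + card E + card (Z \<union> R)"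
    by (rule adapted_basis[OF U W])
  let ?B = "X \<union> E \<union> Z \<union> R"
  let ?F = "\<lambda>b. if b \<in> E then span (Z \<union> R) else if b \<in> X then span Z else {0}"
  have ind: "independent A" if "A \<subseteq> ?B" for A using B(1) that by (rule independent_mono)
  have compl': "span Z \<inter> U = {0}"
    using compl span_mono[of Z "Z \<union> R"] U by (auto simp: span_zero subspace_0)
  have "card (preserving (insert U {W})) * (\<Prod>b\<in>?B. card (?F b)) \<le> card (preserving {W})"
  proof (rule card_preserving_insert[OF B U])
    fix b assume "b \<in> ?B - U"
    moreover have "E \<subseteq> U" "X \<subseteq> U" using sp(2) span_superset by blast+
    ultimately show "?F b = {0}" by auto
  next
    fix f T assume f: "Vector_Spaces.linear scale scale f" "\<And>b. b \<in> ?B \<Longrightarrow> f b \<in> ?F b"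
      and T: "T \<in> {W}"
    interpret f: Vector_Spaces.linear scale scale f by (rule f(1))
    have "f b \<in> W" if "b \<in> X \<union> Z" for b
      using f(2)[of b] that disj span_mono[of Z "X \<union> Z"] subspace_0[OF W]
      by (auto simp: sp(3) split: if_splits)
    then have "span (f ` (X \<union> Z)) \<subseteq> W" by (intro span_minimal W) auto
    then show "f ` T \<subseteq> T" using T f.span_image sp(3) by auto
  qed (use compl compl' U W subspace_0 in auto)
  moreover have "(\<Prod>b\<in>?B. card (?F b)) = (\<Prod>b\<in>E \<union> X. card (?F b))"
    by (rule prod.mono_neutral_cong_right) auto
  moreover have "\<dots> = (\<Prod>b\<in>E. card (?F b)) * (\<Prod>b\<in>X. card (?F b))"
    by (rule prod.union_disjoint) (use disj in auto)
  moreover have "(\<Prod>b\<in>E. card (?F b)) = CARD('f) ^ (card (Z \<union> R) * card E)"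
    using card_span(1)[OF ind[of "Z \<union> R"]] by (simp add: power_mult le_supI1 le_supI2)
  moreover have "(\<Prod>b\<in>X. card (?F b)) = (\<Prod>b\<in>X. card (span Z))"
    by (rule prod.cong) (use disj in auto)
  moreover have "\<dots> = CARD('f) ^ (card Z * card X)"
    using card_span(1)[OF ind[of Z]] by (simp add: power_mult le_supI1 le_supI2)
  ultimately have "card (preserving {U, W})
      * CARD('f) ^ (card (Z \<union> R) * card E + card Z * card X) \<le> card (preserving {W})"
    by (simp add: power_add)
  then show ?thesis by (simp add: dims mult.commute)
qed

text \<open>A proper subspace of a vector space over a field with \<open>q\<close> elements has at most a
  \<open>q\<close>-th of its elements: the multiples of a missing vector \<open>f\<close> represent \<open>q\<close>
  distinct cosets.\<close>

lemma card_preserving_proper: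
  assumes \<U>: "\<And>T. T \<in> \<U> \<Longrightarrow> subspace T" and U: "subspace U"
    and f: "f \<in> preserving \<U>" "f \<notin> preserving (insert U \<U>)"
  shows "card (preserving (insert U \<U>)) * CARD('f) \<le> card (preserving \<U>)"
proof -
  have lf: "Vector_Spaces.linear scale scale f" using f by (simp add: preserving_def)
  let ?h = "\<lambda>(g, c). \<lambda>v. g v + c *s f v"
  let ?D = "preserving (insert U \<U>) \<times> (UNIV :: 'f set)"
  obtain u where u: "u \<in> U" "f u \<notin> U" using f by (auto simp: preserving_def)
  have "inj_on ?h ?D"
  proof (rule inj_onI, safe)
    fix g c g' c'
    assume g: "g \<in> preserving (insert U \<U>)" and g': "g' \<in> preserving (insert U \<U>)"
      and eq: "(\<lambda>v. g v + c *s f v) = (\<lambda>v. g' v + c' *s f v)"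
    show cc: "c = c'"
    proof (rule ccontr)
      assume "c \<noteq> c'"
      have "(c - c') *s f u = g' u - g u"
        using fun_cong[OF eq, of u] by (simp add: algebra_simps)
      moreover have "g' u - g u \<in> U"
        using g g' u U by (auto simp: preserving_def intro!: subspace_diff)
      ultimately have "inverse (c - c') *s (c - c') *s f u \<in> U"
        using subspace_scale[OF U] by simp
      then show False using u \<open>c \<noteq> c'\<close> by simp
    qed
    show "g = g'" using eq cc by (simp add: fun_eq_iff)
  qed
  moreover have "?h ` ?D \<subseteq> preserving \<U>"
  proof (safe)
    fix g c
    assume g: "g \<in> preserving (insert U \<U>)"
    have "(\<lambda>v. g v + c *s f v) ` T \<subseteq> T" if "T \<in> \<U>" for T
      using f(1) g that
      by (auto simp: preserving_def image_subset_iff intro!: subspace_add[OF \<U>[OF that]] subspace_scale[OF \<U>[OF that]])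
    moreover have "Vector_Spaces.linear scale scale (\<lambda>v. g v + c *s f v)"
      using g lf by (intro endo.linear_compose_add endo.linear_compose_scale_right)
        (simp_all add: preserving_def)
    ultimately show "(\<lambda>v. g v + c *s f v) \<in> preserving \<U>" by (simp add: preserving_def)
  qed
  ultimately have "card ?D \<le> card (preserving \<U>)" by (intro card_inj_on_le) auto
  then show ?thesis by (simp add: card_cartesian_product)
qed

lemma card_preserving_empty: "card (preserving {}) \<le> CARD('f) ^ (dimension * dimension)"
proof -
  let ?r = "\<lambda>f. restrict f Basis"
  have "inj_on ?r (preserving {})"
  proof (rule inj_onI)
    fix f g assume "f \<in> preserving {}" "g \<in> preserving {}" and eq: "?r f = ?r g"
    then have "Vector_Spaces.linear scale scale f" "Vector_Spaces.linear scale scale g"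
      by (auto simp: preserving_def)
    moreover have "f b = g b" if "b \<in> Basis" for b
      using fun_cong[OF eq, of b] that by simp
    ultimately show "f = g"
      using endo.linear_eq_on[of f g _ Basis] by (simp add: span_Basis fun_eq_iff)
  qed
  moreover have "?r ` preserving {} \<subseteq> Basis \<rightarrow>\<^sub>E UNIV" by auto
  ultimately have "card (preserving {}) \<le> card (Basis \<rightarrow>\<^sub>E (UNIV :: 'v set))"
    by (intro card_inj_on_le) (auto intro!: finite_PiE)
  also have "\<dots> = CARD('f) ^ (dimension * dimension)"
    using card_span(1)[OF independent_Basis]
    by (simp add: card_PiE span_Basis dimension_def power_mult)
  finally show ?thesis .
qed

text \<open>The maps that act on \<open>W\<close> as a scalar and are arbitrary on a complement of \<open>W\<close>
  preserve every subspace of \<open>W\<close>. Since \<open>W\<close> is nonzero, the scalar is determined.\<close>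

lemma card_preserving_ge:
  assumes W: "subspace W" "W \<noteq> {0}" and \<U>: "\<And>T. T \<in> \<U> \<Longrightarrow> subspace T" "\<And>T. T \<in> \<U> \<Longrightarrow> T \<subseteq> W"
  shows "CARD('f) ^ (1 + dimension * (dimension - dim W)) \<le> card (preserving \<U>)"
proof -
  obtain P where P: "P \<subseteq> W" "independent P" "W \<subseteq> span P" "card P = dim W"
    by (rule basis_exists)
  have spP: "span P = W" by (rule span_subspace[OF P(1,3) W(1)])
  obtain B where B: "P \<subseteq> B" "B \<subseteq> UNIV" "independent B" "UNIV \<subseteq> span B"
    by (rule maximal_independent_subset_extend[OF subset_UNIV P(2)])
  have spB: "span B = UNIV" using B(4) by (rule top.extremum_uniqueI)
  have cardB: "card B = dimension"
    using dim_span_eq_card_independent[OF B(3)] by (simp add: spB dimension_def)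
  obtain p where p: "p \<in> P" using spP W(2) by fastforce
  then have "p \<noteq> 0" using P(2) dependent_zero by blast
  let ?c = "\<lambda>(c, g). endo.construct B (\<lambda>b. if b \<in> P then c *s b else g b)"
  let ?D = "(UNIV :: 'f set) \<times> (B - P \<rightarrow>\<^sub>E (UNIV :: 'v set))"
  have val: "?c (c, g) b = (if b \<in> P then c *s b else g b)" if "b \<in> B" for c g b
    by (simp add: endo.construct_basis[OF B(3) that])
  have lin: "Vector_Spaces.linear scale scale (?c (c, g))" for c g
    by (simp add: endo.linear_construct[OF B(3)])
  have "inj_on ?c ?D"
  proof (rule inj_onI)
    fix u u' assume u: "u \<in> ?D" "u' \<in> ?D" and "?c u = ?c u'"
    moreover obtain c g c' g' where cg: "u = (c, g)" "u' = (c', g')" by (metis surj_pair)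
    ultimately have g: "g \<in> B - P \<rightarrow>\<^sub>E (UNIV :: 'v set)" and g': "g' \<in> B - P \<rightarrow>\<^sub>E (UNIV :: 'v set)"
      and eq: "?c (c, g) = ?c (c', g')" by auto
    have "(if b \<in> P then c *s b else g b) = (if b \<in> P then c' *s b else g' b)" if "b \<in> B" for b
      using fun_cong[OF eq, of b] val[OF that, of c g] val[OF that, of c' g'] by (simp only:)
    note eqb = this
    have "c *s p = c' *s p" using eqb[of p] p B(1) by auto
    then have "c = c'" using \<open>p \<noteq> 0\<close> by simp
    moreover have "g = g'"
    proof (rule PiE_ext[OF g g'])
      fix b assume "b \<in> B - P"
      then show "g b = g' b" using eqb[of b] by simp
    qed
    ultimately show "u = u'" by (simp add: cg)
  qed
  moreover have "?c (c, g) \<in> preserving \<U>" for c g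
  proof -
    have "?c (c, g) w = c *s w" if "w \<in> W" for w
    proof (rule endo.linear_eq_on[OF lin linear_scale_self])
      show "w \<in> span P" using that by (simp add: spP)
      show "?c (c, g) b = c *s b" if "b \<in> P" for b using that B(1) val[of b] by auto
    qed
    then have "?c (c, g) ` T \<subseteq> T" if "T \<in> \<U>" for T
      using \<U>(2)[OF that] subspace_scale[OF \<U>(1)[OF that]] by (auto simp: image_subset_iff)
    then show ?thesis using lin by (simp add: preserving_def)
  qed
  then have "?c ` ?D \<subseteq> preserving \<U>" by auto
  ultimately have "card ?D \<le> card (preserving \<U>)" by (intro card_inj_on_le) auto
  moreover have "card (UNIV :: 'v set) = CARD('f) ^ dimension"
    using card_span(1)[OF B(3)] by (simp add: spB cardB)
  moreover have "card (B - P) = dimension - dim W"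
    using B(1) P(4) cardB by (simp add: card_Diff_subset)
  ultimately show ?thesis
    by (simp add: card_cartesian_product card_PiE power_mult)
qed

abbreviation "\<Omega> m \<equiv> subspaces_of_dim scale m"

lemma mem_PGL_stabilizerE:
  assumes "g \<in> pointwise_stabilizer (PGL scale) (PGL_action scale m) xs" "set xs \<subseteq> \<Omega> m"
  obtains f where "f \<in> carrier (GL scale)" "g = scalars scale #>\<^bsub>GL scale\<^esub> f"
    "\<forall>U\<in>set xs. f ` U = U" "\<forall>U\<in>\<Omega> m. PGL_action scale m g U = f ` U"
proof -
  obtain f where f: "f \<in> carrier (GL scale)" "g = scalars scale #>\<^bsub>GL scale\<^esub> f"
    using assms(1) by (auto simp: mem_pointwise_stabilizer PGL_carrier)
  have act: "PGL_action scale m g U = f ` U" if "U \<in> \<Omega> m" for U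
    using PGL_action_coset[OF vector_space_axioms that f(1)] f(2) by simp
  moreover have "f ` U = U" if "U \<in> set xs" for U
    using that act[of U] assms by (auto simp: mem_pointwise_stabilizer)
  ultimately show ?thesis by (intro that[OF f]) blast+
qed

lemma coset_in_PGL_stabilizer:
  assumes "f \<in> carrier (GL scale)" "set xs \<subseteq> \<Omega> m" "\<And>U. U \<in> set xs \<Longrightarrow> f ` U = U"
  shows "scalars scale #>\<^bsub>GL scale\<^esub> f
    \<in> pointwise_stabilizer (PGL scale) (PGL_action scale m) xs"
proof -
  have "PGL_action scale m (scalars scale #>\<^bsub>GL scale\<^esub> f) U = U" if "U \<in> set xs" for U
    using PGL_action_coset[OF vector_space_axioms _ assms(1), of U m] assms that by auto
  then show ?thesis using assms(1) by (auto simp: mem_pointwise_stabilizer PGL_carrier)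
qed

section \<open>The upper bound\<close>

text \<open>The passage from groups to algebras: an invertible map moving \<open>U\<close> cannot map \<open>U\<close>
  into itself, because \<open>U\<close> is finite.\<close>

lemma irredundant_chain_PGL_preserving:
  assumes "irredundant_chain (PGL scale) (PGL_action scale m) (xs @ [U])" "set (xs @ [U]) \<subseteq> \<Omega> m"
  obtains f where "f \<in> preserving (set xs)" "f \<notin> preserving (insert U (set xs))"
proof -
  obtain g where g: "g \<in> pointwise_stabilizer (PGL scale) (PGL_action scale m) xs"
    "PGL_action scale m g U \<noteq> U"
    using assms(1) by (auto simp: irredundant_chain_snoc)
  obtain f where f: "f \<in> carrier (GL scale)" "\<forall>T\<in>set xs. f ` T = T"
    "\<forall>T\<in>\<Omega> m. PGL_action scale m g T = f ` T"
    by (rule mem_PGL_stabilizerE[OF g(1)]) (use assms(2) in auto)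
  have lin: "Vector_Spaces.linear scale scale f" and "inj f"
    using f(1) by (auto simp: GL_def bij_is_inj)
  have "f ` U \<noteq> U" using g(2) f(3) assms(2) by auto
  moreover have "card (f ` U) = card U"
    by (rule card_image) (rule inj_on_subset[OF \<open>inj f\<close> subset_UNIV])
  ultimately have "\<not> f ` U \<subseteq> U" using card_subset_eq[of U "f ` U"] by auto
  then show ?thesis using that[of f] lin f(2) by (auto simp: preserving_def)
qed

lemma dim_Un_subspaces:
  assumes "subspace U"
  shows "dim (U \<union> S) + dim (U \<inter> span S) = dim U + dim S"
proof -
  have "dim (U \<union> S) = dim (span (U \<union> S))" by simp
  also have "span (U \<union> S) = {x + y |x y. x \<in> U \<and> y \<in> span S}"
    unfolding span_Un using assms by (simp only: span_eq_iff[THEN iffD2])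
  finally show ?thesis using dim_sums_Int[OF assms, of "span S"] by simp
qed

text \<open>The invariant of the upper bound. Induction starts at two subspaces, as for a single one
  the left side is \<open>1 + d\<^sup>2 - m (d - m)\<close>, which exceeds the right side when \<open>m > 1\<close>.\<close>

lemma irredundant_chain_card_bound:
  fixes m :: nat and d :: real
  assumes "set xs \<subseteq> \<Omega> m" "irredundant_chain (PGL scale) (PGL_action scale m) xs" "2 \<le> length xs"
    and m: "1 \<le> m"
  defines "d \<equiv> real dimension"
  shows "length xs + log CARD('f) (card (preserving (set xs)))
    \<le> (real m + 1) * dim (\<Union> (set xs)) - 2 * real m + 2 + d * (d - dim (\<Union> (set xs)))"
  using assms(1-3)
proof (induction xs rule: rev_induct)
  case (snoc U xs)
  let ?q = "real CARD('f)"
  let ?L = "\<lambda>\<U>. log ?q (card (preserving \<U>))"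
  have q: "2 \<le> ?q" using two_le_card_field by simp
  have pos: "0 < card (preserving \<U>)" for \<U>
  proof -
    have "id \<in> preserving \<U>" using linear_id by (auto simp: preserving_def)
    then show ?thesis by (auto simp: card_gt_0_iff)
  qed
  have log_le: "?L \<U> + n \<le> ?L \<V>"
    if "card (preserving \<U>) * CARD('f) ^ n \<le> card (preserving \<V>)" for \<U> \<V> n
  proof -
    have "real (card (preserving \<U>)) * ?q ^ n \<le> card (preserving \<V>)"
      using that by (metis of_nat_le_iff of_nat_mult of_nat_power)
    then have "log ?q (card (preserving \<U>) * ?q ^ n) \<le> ?L \<V>"
      using q pos[of \<U>] by (intro log_mono) auto
    then show ?thesis using q pos[of \<U>] by (simp add: log_mult log_nat_power card_gt_0_iff)
  qed
  have sub: "subspace T" "dim T = m" if "T \<in> insert U (set xs)" for T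
    using snoc.prems(1) that by (auto simp: subspaces_of_dim_def)
  have U: "subspace U" "dim U = m" by (auto intro: sub)
  have mono: "irredundant_chain (PGL scale) (PGL_action scale m) xs"
    using snoc.prems(2) by (simp add: irredundant_chain_snoc)
  obtain f where f: "f \<in> preserving (set xs)" "f \<notin> preserving (insert U (set xs))"
    using irredundant_chain_PGL_preserving[OF snoc.prems(2,1)] .
  \<comment> \<open>\<open>e\<close> is the number of dimensions that \<open>U\<close> adds to the sum of the earlier subspaces.\<close>
  define w e where "w = real (dim (\<Union> (set xs)))" and "e = real m - real (dim (U \<inter> span (\<Union> (set xs))))"
  have w': "real (dim (\<Union> (set (xs @ [U])))) = w + e"
    using dim_Un_subspaces[OF U(1), of "\<Union> (set xs)"] U(2)
    by (simp add: w_def e_def Un_commute)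
  have dm: "m \<le> dimension" using dim_subset_UNIV[of U] U by simp
  have Ule: "dim (U \<inter> T) \<le> m" for T using dim_subset[of "U \<inter> T" U] U by simp
  have Lfac: "real ((m - dim (U \<inter> T)) * (dimension - m)) = (m - dim (U \<inter> T)) * (d - m)" for T
    using dm Ule[of T] by (simp add: d_def of_nat_diff)
  show ?case
  proof (cases "length xs = 1")
    case True
    then obtain W where xs: "xs = [W]" by (cases xs) auto
    have W: "subspace W" "dim W = m" using sub[of W] xs by auto
    have eW: "e = real (m - dim (U \<inter> W))" "w = m"
      using W Ule[of W] by (simp_all add: e_def w_def xs of_nat_diff span_eq_iff[THEN iffD2])
    have "U \<noteq> W" using f by (auto simp: xs)
    then have "dim (U \<inter> W) \<noteq> m"
      using subspace_dim_equal[of "U \<inter> W" U] subspace_dim_equal[of "U \<inter> W" W] U W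
        subspace_inter[OF U(1) W(1)] by auto
    then have e: "1 \<le> e" "e \<le> m" using eW Ule[of W] by auto
    have "?L {U, W} + ((m - dim (U \<inter> W)) * (dimension - m) + dim (U \<inter> W) * (m - dim (U \<inter> W)))
        \<le> ?L {W}"
      using log_le[OF card_preserving_pair[OF U(1) W(1)]] U W by simp
    moreover have "real (dim (U \<inter> W)) = m - e" using eW(1) Ule[of W] by (simp add: of_nat_diff)
    then have "real ((m - dim (U \<inter> W)) * (dimension - m) + dim (U \<inter> W) * (m - dim (U \<inter> W)))
        = e * (d - m) + (m - e) * e"
      by (simp only: of_nat_add Lfac of_nat_mult[of "dim (U \<inter> W)"] eW(1)[symmetric])
    ultimately have L2: "?L {U, W} + e * (d - m) + (m - e) * e \<le> ?L {W}" by linarith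
    have "card (preserving {W}) * CARD('f) ^ (m * (dimension - m)) \<le> card (preserving {})"
      using card_preserving_insert_transversal[OF W(1) subspace_single_0, of "{}"] W(2)
      by (simp add: subspace_0[OF W(1)] Int_absorb1)
    from log_le[OF this] have L1: "?L {W} + m * (d - m) \<le> ?L {}"
      using dm by (simp add: d_def of_nat_diff)
    have "?L {} \<le> log ?q (?q ^ (dimension * dimension))"
      using card_preserving_empty pos[of "{}"] q
      by (intro log_mono) (simp_all flip: of_nat_power)
    then have L0: "?L {} \<le> d * d" using q by (simp add: log_nat_power d_def)
    \<comment> \<open>The right side of the claim exceeds what the three estimates give by exactly this product.\<close>
    have "0 \<le> (e - 1) * (m - e)" using e by simp
    with L0 L1 L2 have "2 + ?L {U, W} \<le> (real m + 1) * (real m + e) - 2 * m + 2 + d * (d - (m + e))"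
      by (simp add: algebra_simps)
    then show ?thesis unfolding w' using eW(2) by (simp add: xs insert_commute algebra_simps)
  next
    case False
    then have len: "2 \<le> length xs" using snoc.prems(3) by auto
    have IH: "length xs + ?L (set xs) \<le> (real m + 1) * w - 2 * m + 2 + d * (d - w)"
      using snoc.IH[OF _ mono len] snoc.prems(1) by (simp add: w_def)
    have "?L (insert U (set xs)) + 1 \<le> (real m + 1) * e - d * e + ?L (set xs)"
    proof (cases "e = 0")
      case True
      then show ?thesis
        using log_le[of "insert U (set xs)" 1 "set xs"]
          card_preserving_proper[OF _ U(1) f] sub by simp
    next
      case False
      let ?W = "span (\<Union> (set xs))"
      have eW: "e = real (m - dim (U \<inter> ?W))" using Ule[of ?W] by (simp add: e_def of_nat_diff)
      then have e: "1 \<le> e" using False by simp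
      have "?L (insert U (set xs)) + e * (d - m) \<le> ?L (set xs)"
        using log_le[OF card_preserving_insert_transversal[OF U(1) subspace_span[of "\<Union> (set xs)"], of "set xs"]]
          sub Lfac[of ?W] span_superset[of "\<Union> (set xs)"] eW U(2) by fastforce
      then show ?thesis using e by (simp add: algebra_simps)
    qed
    with IH show ?thesis unfolding w' by (simp add: algebra_simps)
  qed
qed simp

lemma irredundant_chain_length_le:
  assumes xs: "set xs \<subseteq> \<Omega> m" "irredundant_chain (PGL scale) (PGL_action scale m) xs"
    and m: "1 \<le> m" and d: "2 \<le> dimension"
  shows "int (length xs) \<le> (int m + 1) * int dimension - 2 * int m + 1"
  \<comment> \<open>For \<open>l \<ge> 2\<close>, compare the invariant with the size of the last algebra; the terms
    \<open>d (d - w)\<close> cancel.\<close>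
proof (cases "2 \<le> length xs")
  case False
  have "(int m + 1) * 2 \<le> (int m + 1) * int dimension" using d by (intro mult_left_mono) auto
  then show ?thesis using False by simp
next
  case True
  let ?q = "real CARD('f)"
  let ?W = "span (\<Union> (set xs))"
  let ?w = "dim (\<Union> (set xs))"
  have q: "2 \<le> ?q" using two_le_card_field by simp
  obtain U where U: "U \<in> set xs" using True by (cases xs) auto
  have "dim U = m" using U xs(1) by (auto simp: subspaces_of_dim_def)
  then have "\<not> U \<subseteq> {0}" using m dim_eq_0[of U] by simp
  moreover have "U \<subseteq> ?W" using U span_superset[of "\<Union> (set xs)"] by blast
  ultimately have "?W \<noteq> {0}" by blast
  then have "CARD('f) ^ (1 + dimension * (dimension - dim ?W)) \<le> card (preserving (set xs))"
    using xs(1) span_superset[of "\<Union> (set xs)"]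
    by (intro card_preserving_ge) (auto simp: subspaces_of_dim_def)
  then have "?q ^ (1 + dimension * (dimension - ?w)) \<le> real (card (preserving (set xs)))"
    by (metis dim_span of_nat_le_iff of_nat_power)
  then have le: "log ?q (?q ^ (1 + dimension * (dimension - ?w))) \<le> log ?q (card (preserving (set xs)))"
    using q by (intro log_mono) auto
  have "log ?q (?q ^ n) = n" for n using q by (simp add: log_nat_power)
  note le[unfolded this]
  moreover have w: "?w \<le> dimension" by (rule dim_subset_UNIV)
  ultimately have "1 + dimension * (real dimension - ?w) \<le> log ?q (card (preserving (set xs)))"
    by (simp add: of_nat_diff)
  with irredundant_chain_card_bound[OF xs True m]
  have "real (length xs) \<le> (real m + 1) * ?w - 2 * real m + 1" by simp
  also have "\<dots> \<le> (real m + 1) * dimension - 2 * real m + 1"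
    using w by (intro add_right_mono diff_right_mono mult_left_mono) auto
  also have "\<dots> = real_of_int ((int m + 1) * int dimension - 2 * int m + 1)" by simp
  finally show ?thesis by linarith
qed

section \<open>The lower bound\<close>

lemma GL_image_span:
  assumes "f \<in> carrier (GL scale)"
  shows "f ` span S = span (f ` S)"
proof -
  interpret f: Vector_Spaces.linear scale scale f using assms by (simp add: GL_def)
  show ?thesis by (rule f.span_image[symmetric])
qed

lemma GL_extending:
  assumes "span (g ` Basis) = UNIV"
  obtains f where "f \<in> carrier (GL scale)" "\<forall>b\<in>Basis. f b = g b"
proof -
  let ?f = "endo.construct Basis g"
  have lin: "Vector_Spaces.linear scale scale ?f"
    by (rule endo.linear_construct[OF independent_Basis])
  interpret f: Vector_Spaces.linear scale scale ?f by (rule lin)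
  have val: "?f b = g b" if "b \<in> Basis" for b
    by (rule endo.construct_basis[OF independent_Basis that])
  have "range ?f = span (?f ` Basis)" by (simp add: f.span_image span_Basis)
  also have "?f ` Basis = g ` Basis" using val by simp
  finally have "surj ?f" using assms by simp
  then have "?f \<in> carrier (GL scale)"
    using lin linear_surj_imp_inj[OF lin] by (simp add: GL_def bij_def)
  then show ?thesis using val that by blast
qed

lemma notin_span_Basis: "b \<in> Basis \<Longrightarrow> S \<subseteq> Basis \<Longrightarrow> b \<notin> S \<Longrightarrow> b \<notin> span S"
  using independent_Basis span_mono[of S "Basis - {b}"] unfolding dependent_def by blast

lemma span_Basis_subset_in:
  assumes "S \<subseteq> Basis" "card S = m"
  shows "span S \<in> \<Omega> m"
  using assms independent_mono[OF independent_Basis assms(1)]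
  by (simp add: subspaces_of_dim_def dim_eq_card_independent)

text \<open>The map \<open>b \<mapsto> a + b\<close> moves exactly those coordinate subspaces that contain \<open>b\<close> but
  not \<open>a\<close>.\<close>

lemma transvection:
  assumes ab: "a \<in> Basis" "b \<in> Basis" "a \<noteq> b"
  obtains f where "f \<in> carrier (GL scale)"
    "\<And>S. S \<subseteq> Basis \<Longrightarrow> f ` span S = span S \<longleftrightarrow> \<not> (b \<in> S \<and> a \<notin> S)"
proof -
  define g where "g = (\<lambda>x. if x = b then a + b else x)"
  have stab: "span (g ` S) = span S" if "\<not> (b \<in> S \<and> a \<notin> S)" for S
  proof (cases "b \<in> S")
    case True
    then have "a \<in> S" using that by simp
    have "g x \<in> span S" if "x \<in> S" for x
      using that True \<open>a \<in> S\<close> by (auto simp: g_def intro: span_base span_add)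
    moreover have "x \<in> span (g ` S)" if "x \<in> S" for x
    proof (cases "x = b")
      case True
      have "a \<in> span (g ` S)" using \<open>a \<in> S\<close> ab by (intro span_base) (force simp: g_def)
      moreover have "a + b \<in> span (g ` S)" using that True by (intro span_base) (force simp: g_def)
      ultimately show ?thesis using span_add_eq True by blast
    next
      case False
      then show ?thesis using that by (intro span_base) (force simp: g_def)
    qed
    ultimately show ?thesis unfolding span_eq by blast
  next
    case False
    then have "g ` S = S" by (force simp: g_def)
    then show ?thesis by simp
  qed
  have "span (g ` Basis) = UNIV" using stab[of Basis] ab by (simp add: span_Basis)
  then obtain f where f: "f \<in> carrier (GL scale)" "\<forall>x\<in>Basis. f x = g x"
    by (rule GL_extending)
  have im: "f ` span S = span (g ` S)" if "S \<subseteq> Basis" for S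
  proof -
    have "f ` S = g ` S" using f(2) that by (intro image_cong) auto
    then show ?thesis by (simp add: GL_image_span[OF f(1)])
  qed
  have "f ` span S \<noteq> span S" if S: "S \<subseteq> Basis" "b \<in> S" "a \<notin> S" for S
  proof
    assume eq: "f ` span S = span S"
    have "a + b \<in> f ` span S"
      using f(2) ab(2) span_base[OF S(2)] by (force simp: g_def)
    then have "a \<in> span S" using eq span_add_eq2[OF span_base[OF S(2)], of a] by simp
    then show False using notin_span_Basis ab(1) S by blast
  qed
  then show ?thesis using that[OF f(1)] im stab by metis
qed

lemma dilation:
  assumes i: "i \<in> Basis" and c: "c \<noteq> 0"
  obtains f where "f \<in> carrier (GL scale)" "f i = c *s i" "\<And>b. b \<in> Basis - {i} \<Longrightarrow> f b = b"
    "\<And>S. S \<subseteq> Basis \<Longrightarrow> f ` span S = span S"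
proof -
  define g where "g = (\<lambda>x. if x = i then c *s i else x)"
  have stab: "span (g ` S) = span S" for S
  proof -
    have "g x \<in> span S" if "x \<in> S" for x
      using that by (auto simp: g_def intro: span_base span_scale)
    moreover have "x \<in> span (g ` S)" if "x \<in> S" for x
    proof (cases "x = i")
      case True
      have "c *s i \<in> span (g ` S)" using that True by (intro span_base) (force simp: g_def)
      then have "inverse c *s c *s i \<in> span (g ` S)" by (rule span_scale)
      then show ?thesis using c True by simp
    next
      case False
      then show ?thesis using that by (intro span_base) (force simp: g_def)
    qed
    ultimately show ?thesis unfolding span_eq by blast
  qed
  have "span (g ` Basis) = UNIV" using stab[of Basis] by (simp add: span_Basis)
  then obtain f where f: "f \<in> carrier (GL scale)" "\<forall>x\<in>Basis. f x = g x"
    by (rule GL_extending)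
  have im: "f ` span S = span S" if "S \<subseteq> Basis" for S
  proof -
    have "f ` S = g ` S" using f(2) that by (intro image_cong) auto
    then show ?thesis by (simp add: GL_image_span[OF f(1)] stab)
  qed
  show ?thesis by (rule that[OF f(1) _ _ im]) (use f(2) i in \<open>auto simp: g_def\<close>)
qed

lemma irredundant_chain_PGL_append:
  assumes "irredundant_chain (PGL scale) (PGL_action scale m) xs" "set xs \<subseteq> \<Omega> m"
    and I: "finite I" "\<And>i. i \<in> I \<Longrightarrow> y i \<in> \<Omega> m"
    and wit: "\<And>i. i \<in> I \<Longrightarrow> \<exists>f\<in>carrier (GL scale). (\<forall>U\<in>set xs. f ` U = U) \<and>
      (\<forall>j\<in>I - {i}. f ` y j = y j) \<and> f ` y i \<noteq> y i"
  obtains ys where "set ys = y ` I" "length ys = card I"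
    "irredundant_chain (PGL scale) (PGL_action scale m) (xs @ ys)"
proof -
  obtain js where js: "set js = I" "distinct js" using finite_distinct_list[OF I(1)] by blast
  have "irredundant_chain (PGL scale) (PGL_action scale m) (xs @ map y js)"
  proof (rule irredundant_chain_append_independent[OF assms(1) js(2)])
    fix i assume "i \<in> set js"
    then have i: "i \<in> I" using js(1) by simp
    obtain f where f: "f \<in> carrier (GL scale)" "\<forall>U\<in>set xs. f ` U = U"
      "\<forall>j\<in>I - {i}. f ` y j = y j" "f ` y i \<noteq> y i"
      using wit[OF i] by (elim bexE conjE)
    have act: "PGL_action scale m (scalars scale #>\<^bsub>GL scale\<^esub> f) (y j) = f ` y j" if "j \<in> I" for j
      by (rule PGL_action_coset[OF vector_space_axioms I(2)[OF that] f(1)])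
    show "\<exists>g\<in>pointwise_stabilizer (PGL scale) (PGL_action scale m) xs.
      (\<forall>j\<in>set js - {i}. PGL_action scale m g (y j) = y j) \<and> PGL_action scale m g (y i) \<noteq> y i"
      by (rule bexI[OF _ coset_in_PGL_stabilizer[OF f(1) assms(2)]])
         (use act f i js(1) in auto)
  qed
  then show ?thesis using that[of "map y js"] js distinct_card[OF js(2)] by simp
qed

text \<open>The first subspace is spanned by \<open>M\<close>, the others by the sets obtained from \<open>M\<close> by
  exchanging one element \<open>a\<close> for one \<open>b\<close> outside. Among all these sets, only the one
  for \<open>(a, b)\<close> contains \<open>b\<close> without \<open>a\<close>, so the transvection \<open>b \<mapsto> a + b\<close> singles
  it out.\<close>

lemma exists_transvection_chain:
  assumes m: "1 \<le> m" "m < dimension"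
  obtains xs \<S> where "irredundant_chain (PGL scale) (PGL_action scale m) xs"
    "length xs = m * (dimension - m) + 1" "set xs = span ` \<S>"
    "\<forall>S\<in>\<S>. S \<subseteq> Basis \<and> card S = m"
proof -
  have d: "card Basis = dimension" by (simp add: dimension_def)
  then obtain M where M: "M \<subseteq> Basis" "card M = m"
    using m obtain_subset_with_card_n[of m Basis] by auto
  have M': "M \<noteq> {}" "Basis - M \<noteq> {}" using M m d by auto
  \<comment> \<open>For the one-element chain, any map moving the span of \<open>M\<close> is a witness.\<close>
  obtain x0 where x0: "set x0 = (\<lambda>_. span M) ` {()}" "length x0 = card {()}"
    "irredundant_chain (PGL scale) (PGL_action scale m) ([] @ x0)"
  proof (rule irredundant_chain_PGL_append[of m "[]" "{()}" "\<lambda>_. span M"])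
    obtain a b where ab: "a \<in> Basis - M" "b \<in> M" using M' by blast
    obtain f where f: "f \<in> carrier (GL scale)"
      "\<And>S. S \<subseteq> Basis \<Longrightarrow> f ` span S = span S \<longleftrightarrow> \<not> (b \<in> S \<and> a \<notin> S)"
      by (rule transvection[of a b]) (use ab M in auto)
    have "f ` span M \<noteq> span M" using f(2)[OF M(1)] ab by simp
    with f(1) show "\<exists>f\<in>carrier (GL scale). (\<forall>U\<in>set []. f ` U = U) \<and>
        (\<forall>j\<in>{()} - {i}. f ` span M = span M) \<and> f ` span M \<noteq> span M" for i
      by auto
  qed (use M span_Basis_subset_in in auto)
  let ?S = "\<lambda>(a, b). insert b (M - {a})"
  let ?I = "M \<times> (Basis - M)"
  have S: "?S p \<subseteq> Basis" "card (?S p) = m" if "p \<in> ?I" for p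
    using that M m by (auto simp: card_insert_if)
  obtain xs where xs: "set xs = (\<lambda>p. span (?S p)) ` ?I" "length xs = card ?I"
    "irredundant_chain (PGL scale) (PGL_action scale m) (x0 @ xs)"
  proof (rule irredundant_chain_PGL_append[of m x0 ?I "\<lambda>p. span (?S p)"])
    fix p assume p: "p \<in> ?I"
    then obtain a b where ab: "p = (a, b)" "a \<in> M" "b \<in> Basis" "b \<notin> M" by auto
    obtain f where f: "f \<in> carrier (GL scale)"
      "\<And>S. S \<subseteq> Basis \<Longrightarrow> f ` span S = span S \<longleftrightarrow> \<not> (b \<in> S \<and> a \<notin> S)"
      by (rule transvection[of a b]) (use ab M in auto)
    have "f ` span M = span M" using f(2)[OF M(1)] ab by simp
    moreover have "f ` span (?S r) = span (?S r)" if "r \<in> ?I - {p}" for r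
      using f(2)[OF S(1), of r] that ab by auto
    moreover have "f ` span (?S p) \<noteq> span (?S p)"
      using f(2)[OF S(1)[OF p]] ab by auto
    ultimately show "\<exists>f\<in>carrier (GL scale). (\<forall>U\<in>set x0. f ` U = U) \<and>
      (\<forall>j\<in>?I - {p}. f ` span (?S j) = span (?S j)) \<and> f ` span (?S p) \<noteq> span (?S p)"
      by (intro bexI[OF _ f(1)] conjI ballI) (simp_all add: x0(1))
  next
    show "irredundant_chain (PGL scale) (PGL_action scale m) x0" using x0(3) by simp
    show "set x0 \<subseteq> \<Omega> m" using span_Basis_subset_in[OF M] by (simp add: x0(1))
    show "span (?S p) \<in> \<Omega> m" if "p \<in> ?I" for p by (rule span_Basis_subset_in[OF S[OF that]])
  qed simp
  have "card (Basis - M) = dimension - m"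
    using M d by (simp add: card_Diff_subset)
  then have "length (x0 @ xs) = m * (dimension - m) + 1"
    using x0(2) xs(2) M(2) by (simp add: card_cartesian_product)
  moreover have "set (x0 @ xs) = span ` insert M (?S ` ?I)"
    using x0(1) xs(1) by (simp add: image_image)
  ultimately show ?thesis
    using that[OF xs(3)] S M by blast
qed

text \<open>Diagonal maps fix all coordinate subspaces, and multiplying the basis vector \<open>i\<close> by
  \<open>c \<notin> {0, 1}\<close> moves the span of \<open>e + i\<close> and further basis vectors, while it fixes the
  analogous spans for the other basis vectors. This is the point where the field with two
  elements has to be excluded.\<close>

lemma exists_dilation_chain:
  assumes m: "1 \<le> m" "m < dimension" and q: "CARD('f) \<noteq> 2"
    and xs: "irredundant_chain (PGL scale) (PGL_action scale m) xs"
    "set xs = span ` \<S>" "\<forall>S\<in>\<S>. S \<subseteq> Basis \<and> card S = m"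
  obtains ys where "irredundant_chain (PGL scale) (PGL_action scale m) (xs @ ys)"
    "length ys = dimension - 1" "set ys \<subseteq> \<Omega> m"
proof -
  have d: "card Basis = dimension" by (simp add: dimension_def)
  obtain c :: 'f where c: "c \<noteq> 0" "c \<noteq> 1"
  proof -
    have "(UNIV :: 'f set) \<noteq> {0, 1}" using q by (metis card_2_iff zero_neq_one)
    then show ?thesis using that by blast
  qed
  obtain e where e: "e \<in> Basis" using m d by (metis all_not_in_conv card.empty not_less_zero)
  have "\<exists>N. N \<subseteq> Basis - {e, i} \<and> card N = m - 1" if "i \<in> Basis - {e}" for i
  proof -
    have "card (Basis - {e, i}) = dimension - 2" using that e d by (auto simp: card_Diff_subset card_insert_if)
    then have "m - 1 \<le> card (Basis - {e, i})" using m by simp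
    then show ?thesis by (metis obtain_subset_with_card_n)
  qed
  then obtain N where N: "\<And>i. i \<in> Basis - {e} \<Longrightarrow> N i \<subseteq> Basis - {e, i} \<and> card (N i) = m - 1"
    by metis
  let ?T = "\<lambda>i. span (insert (e + i) (N i))"
  have T_in: "?T i \<in> \<Omega> m" if i: "i \<in> Basis - {e}" for i
  proof -
    have "independent (N i)" using N[OF i] by (intro independent_mono[OF independent_Basis]) auto
    moreover have "e + i \<notin> span (N i)"
    proof
      assume "e + i \<in> span (N i)"
      then have "e + i \<in> span (Basis - {e})" using N[OF i] span_mono[of "N i" "Basis - {e}"] by blast
      then have "e \<in> span (Basis - {e})" using span_add_eq2[OF span_base[OF i], of e] by simp
      then show False using notin_span_Basis[OF e, of "Basis - {e}"] by blast
    qed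
    ultimately have "independent (insert (e + i) (N i))" by (intro independent_insertI)
    moreover have "e + i \<notin> N i" using \<open>e + i \<notin> span (N i)\<close> span_base by blast
    then have "card (insert (e + i) (N i)) = m" using N[OF i] m by simp
    ultimately show ?thesis by (simp add: subspaces_of_dim_def dim_eq_card_independent)
  qed
  obtain ys where "set ys = ?T ` (Basis - {e})" "length ys = card (Basis - {e})"
    "irredundant_chain (PGL scale) (PGL_action scale m) (xs @ ys)"
  proof (rule irredundant_chain_PGL_append[OF xs(1), of "Basis - {e}" ?T])
    show "set xs \<subseteq> \<Omega> m" using xs span_Basis_subset_in by auto
    fix i assume i: "i \<in> Basis - {e}"
    obtain f where f: "f \<in> carrier (GL scale)" "f i = c *s i" "\<And>b. b \<in> Basis - {i} \<Longrightarrow> f b = b"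
      "\<And>S. S \<subseteq> Basis \<Longrightarrow> f ` span S = span S"
      by (rule dilation[of i c]) (use i c in auto)
    interpret f: Vector_Spaces.linear scale scale f using f(1) by (simp add: GL_def)
    have "f ` U = U" if U: "U \<in> set xs" for U
    proof -
      obtain S where "U = span S" "S \<in> \<S>" using U unfolding xs(2) by (rule imageE)
      then show ?thesis using f(4)[of S] xs(3) by simp
    qed
    moreover have "f ` ?T j = ?T j" if j: "j \<in> Basis - {e} - {i}" for j
    proof -
      have "f (e + j) = e + j" using f(3)[of e] f(3)[of j] i j e by (auto simp: f.add)
      moreover have "span (f ` N j) = span (N j)"
        using f(4)[of "N j"] N[of j] j GL_image_span[OF f(1)] by auto
      ultimately show ?thesis
        unfolding GL_image_span[OF f(1)] image_insert by (simp only: span_insert)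
    qed
    moreover have "f ` ?T i \<noteq> ?T i"
    proof
      assume eq: "f ` ?T i = ?T i"
      have base: "e + i \<in> ?T i" by (simp add: span_base)
      then have "f (e + i) \<in> ?T i" using eq by blast
      then have "f (e + i) - (e + i) \<in> ?T i" using base by (rule span_diff)
      moreover have "f (e + i) - (e + i) = (c - 1) *s i"
        using f(2) f(3)[of e] i e by (auto simp: f.add scale_left_diff_distrib)
      ultimately have "inverse (c - 1) *s (c - 1) *s i \<in> ?T i" by (metis span_scale)
      then have iT: "i \<in> ?T i" using c by simp
      then have eT: "e \<in> ?T i" using base span_add_eq2[OF iT] by blast
      \<comment> \<open>Now \<open>?T i\<close> contains \<open>m + 1\<close> basis vectors.\<close>
      have "card (insert e (insert i (N i))) \<le> dim (?T i)"
        using iT eT i e N[OF i]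
        by (intro independent_card_le_dim independent_mono[OF independent_Basis])
           (auto intro: span_base)
      moreover have "card (insert e (insert i (N i))) = m + 1"
      proof -
        have "e \<notin> insert i (N i)" "i \<notin> N i" using N[OF i] i by auto
        then show ?thesis using N[OF i] m by simp
      qed
      ultimately show False using T_in[OF i] by (simp add: subspaces_of_dim_def)
    qed
    ultimately show "\<exists>f\<in>carrier (GL scale). (\<forall>U\<in>set xs. f ` U = U) \<and>
      (\<forall>j\<in>Basis - {e} - {i}. f ` ?T j = ?T j) \<and> f ` ?T i \<noteq> ?T i"
      by (intro bexI[OF _ f(1)] conjI ballI)
  qed (use T_in in auto)
  then show ?thesis using that[of ys] T_in e d by auto
qed

text \<open>The action is faithful. If \<open>v\<close> and \<open>f v\<close> were independent, some \<open>m\<close>-subspace would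
  contain \<open>v\<close> but not \<open>f v\<close>, as \<open>m < d\<close>; so every vector is an eigenvector, and a
  linear map with that property is scalar.\<close>

lemma scalar_if_fixes_all:
  assumes f: "f \<in> carrier (GL scale)" and m: "1 \<le> m" "m < dimension"
    and fixes_all: "\<And>U. U \<in> \<Omega> m \<Longrightarrow> f ` U = U"
  shows "f \<in> scalars scale"
proof -
  interpret f: Vector_Spaces.linear scale scale f using f by (simp add: GL_def)
  have eigen: "\<exists>c. f v = c *s v" for v
  proof (cases "f v \<in> span {v}")
    case True
    then show ?thesis by (auto simp: span_singleton)
  next
    case False
    then have v: "v \<noteq> 0" "f v \<notin> {v}" using span_base by (auto simp: f.zero span_zero)
    have "independent {v, f v}"
      using independent_insertI[OF False] v by (simp add: insert_commute)
    then obtain B where B: "{v, f v} \<subseteq> B" "B \<subseteq> UNIV" "independent B" "UNIV \<subseteq> span B"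
      by (rule maximal_independent_subset_extend[OF subset_UNIV])
    have "span B = UNIV" using B(4) by (rule top.extremum_uniqueI)
    then have cB: "card B = dimension"
      using dim_span_eq_card_independent[OF B(3)] by (simp add: dimension_def)
    have "m - 1 \<le> card (B - {v, f v})" using cB B(1) v m by (simp add: card_Diff_subset)
    then obtain N where N: "N \<subseteq> B - {v, f v}" "card N = m - 1"
      by (metis obtain_subset_with_card_n)
    have "insert v N \<subseteq> B - {f v}" using N B v by auto
    have "v \<notin> N" using N(1) by blast
    then have "card (insert v N) = m" using N(2) m by simp
    moreover have "independent (insert v N)"
      by (rule independent_mono[OF B(3)]) (use N B in auto)
    ultimately have "span (insert v N) \<in> \<Omega> m"
      by (simp add: subspaces_of_dim_def dim_eq_card_independent)
    then have "f v \<in> span (insert v N)" using fixes_all span_base[of v "insert v N"] by blast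
    then have "f v \<in> span (B - {f v})" using span_mono[OF \<open>insert v N \<subseteq> B - {f v}\<close>] by blast
    then show ?thesis using B(1,3) dependent_def by blast
  qed
  have "Basis \<noteq> {}" using m by (auto simp: dimension_def)
  then obtain b where b: "b \<in> Basis" by blast
  then have "b \<noteq> 0" using independent_Basis dependent_zero by blast
  obtain c where c: "f b = c *s b" using eigen by blast
  \<comment> \<open>The eigenvalues of \<open>b\<close>, \<open>v\<close> and \<open>b + v\<close> agree if \<open>b\<close> and \<open>v\<close> are independent.\<close>
  have "f v = c *s v" for v
  proof (cases "v \<in> span {b}")
    case True
    then obtain k where "v = k *s b" by (auto simp: span_singleton)
    then show ?thesis by (simp add: f.scale c mult.commute)
  next
    case False
    obtain c' where c': "f v = c' *s v" using eigen by blast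
    obtain k where k: "f (b + v) = k *s (b + v)" using eigen by blast
    have "c *s b + c' *s v = k *s b + k *s v"
      using k by (simp add: f.add c c' scale_right_distrib)
    then have rel: "(c' - k) *s v = (k - c) *s b"
      by (simp add: algebra_simps)
    have "c' = k"
    proof (rule ccontr)
      assume "c' \<noteq> k"
      then have "v = inverse (c' - k) *s (c' - k) *s v" by simp
      also have "\<dots> \<in> span {b}" unfolding rel by (intro span_scale span_base) simp
      finally show False using False by simp
    qed
    then show ?thesis using rel \<open>b \<noteq> 0\<close> c' by simp
  qed
  then have "f = scale c" by auto
  moreover have "c \<noteq> 0"
  proof
    assume "c = 0"
    then have "f b = f 0" using c by (simp add: f.zero)
    moreover have "inj f" using f by (simp add: GL_def bij_def)
    ultimately show False using \<open>b \<noteq> 0\<close> by (simp only: inj_eq)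
  qed
  ultimately show ?thesis by (auto simp: scalars_def)
qed

lemma is_base_if_all_subspaces:
  assumes m: "1 \<le> m" "m < dimension" and xs: "set xs = \<Omega> m"
  shows "is_base (PGL scale) (\<Omega> m) (PGL_action scale m) xs"
proof -
  interpret N: normal "scalars scale" "GL scale" by (rule normal_scalars[OF vector_space_axioms])
  have one: "\<one>\<^bsub>PGL scale\<^esub> = scalars scale" by (simp add: PGL_def FactGroup_def)
  have "g = \<one>\<^bsub>PGL scale\<^esub>"
    if g: "g \<in> pointwise_stabilizer (PGL scale) (PGL_action scale m) xs" for g
  proof -
    obtain f where f: "f \<in> carrier (GL scale)" "g = scalars scale #>\<^bsub>GL scale\<^esub> f"
      "\<forall>U\<in>set xs. f ` U = U"
      by (rule mem_PGL_stabilizerE[OF g equalityD1[OF xs]])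
    have "f \<in> scalars scale"
      by (rule scalar_if_fixes_all[OF f(1) m]) (use f(3) xs in simp)
    then show ?thesis using f(2) one N.rcos_const[OF N.is_group] by simp
  qed
  moreover have "\<one>\<^bsub>PGL scale\<^esub> \<in> pointwise_stabilizer (PGL scale) (PGL_action scale m) xs"
  proof -
    have "scalars scale #>\<^bsub>GL scale\<^esub> id = scalars scale"
      using N.coset_mult_one[OF N.subset] by simp
    moreover have "id \<in> carrier (GL scale)" using N.one_closed by simp
    then have "scalars scale #>\<^bsub>GL scale\<^esub> id
        \<in> pointwise_stabilizer (PGL scale) (PGL_action scale m) xs"
      by (rule coset_in_PGL_stabilizer[OF _ equalityD1[OF xs]]) simp
    ultimately show ?thesis by (simp only: one)
  qed
  ultimately have "pointwise_stabilizer (PGL scale) (PGL_action scale m) xs = {\<one>\<^bsub>PGL scale\<^esub>}"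
    by blast
  then show ?thesis by (simp only: is_base_def xs subset_refl simp_thms)
qed

lemma irredundant_chain_PGL_extends_to_base:
  assumes m: "1 \<le> m" "m < dimension"
    and xs: "irredundant_chain (PGL scale) (PGL_action scale m) xs" "set xs \<subseteq> \<Omega> m"
  obtains ys where "irredundant_base (PGL scale) (\<Omega> m) (PGL_action scale m) (xs @ ys)"
proof -
  have "finite (Pow (UNIV :: 'v set))" by (simp only: finite_Pow_iff finite_vectors)
  then have "finite (\<Omega> m)" by (rule rev_finite_subset) simp
  then obtain zs where zs: "set zs = \<Omega> m" using finite_list by blast
  obtain ys where ys: "set ys \<subseteq> set zs" "irredundant_chain (PGL scale) (PGL_action scale m) (xs @ ys)"
    "pointwise_stabilizer (PGL scale) (PGL_action scale m) (xs @ ys)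
      = pointwise_stabilizer (PGL scale) (PGL_action scale m) (xs @ zs)"
    by (rule irredundant_chain_extend[OF xs(1)])
  have "is_base (PGL scale) (\<Omega> m) (PGL_action scale m) (xs @ zs)"
    by (rule is_base_if_all_subspaces[OF m]) (use xs zs in auto)
  then have "irredundant_base (PGL scale) (\<Omega> m) (PGL_action scale m) (xs @ ys)"
    using ys zs xs(2) by (auto simp: irredundant_base_iff is_base_def)
  then show ?thesis by (rule that)
qed

lemma exists_long_irredundant_base:
  assumes m: "1 \<le> m" "m < dimension"
  obtains xs where "irredundant_base (PGL scale) (\<Omega> m) (PGL_action scale m) xs"
    "m * (dimension - m) + (if CARD('f) = 2 then 1 else dimension) \<le> length xs"
proof -
  obtain xs \<S> where xs: "irredundant_chain (PGL scale) (PGL_action scale m) xs"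
    "length xs = m * (dimension - m) + 1" "set xs = span ` \<S>"
    "\<forall>S\<in>\<S>. S \<subseteq> Basis \<and> card S = m"
    by (rule exists_transvection_chain[OF m])
  have "\<exists>ys. irredundant_chain (PGL scale) (PGL_action scale m) (xs @ ys) \<and> set ys \<subseteq> \<Omega> m \<and>
    length ys = (if CARD('f) = 2 then 0 else dimension - 1)"
  proof (cases "CARD('f) = 2")
    case True
    then show ?thesis using xs(1) by (intro exI[of _ "[]"]) simp
  next
    case False
    show ?thesis using exists_dilation_chain[OF m False xs(1,3,4)] False by (metis (no_types))
  qed
  then obtain ys where ys: "irredundant_chain (PGL scale) (PGL_action scale m) (xs @ ys)"
    "set ys \<subseteq> \<Omega> m" "length ys = (if CARD('f) = 2 then 0 else dimension - 1)" by blast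
  have "set (xs @ ys) \<subseteq> \<Omega> m" using xs(3,4) ys(2) span_Basis_subset_in by auto
  then obtain zs where "irredundant_base (PGL scale) (\<Omega> m) (PGL_action scale m) ((xs @ ys) @ zs)"
    by (rule irredundant_chain_PGL_extends_to_base[OF m ys(1)])
  then show ?thesis using that xs(2) ys(3) m by fastforce
qed

end

theorem theorem3p1:
  fixes s :: "'f::{field, finite} \<Rightarrow> 'v::ab_group_add \<Rightarrow> 'v"
    and q d m :: nat
  assumes "primepow q" and "CARD('f) = q"
    and "d \<ge> 2" and "1 \<le> m" and "m \<le> d - 1"
    and "vector_space s" and "vector_space.dim s UNIV = d"
  shows "int (max_irredundant (PGL s) (subspaces_of_dim s m) (PGL_action s m))
           \<le> (int m + 1) * int d - 2 * int m + 1
       \<and> int (max_irredundant (PGL s) (subspaces_of_dim s m) (PGL_action s m))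
           \<ge> (if q = 2 then int m * int d - (int m)\<^sup>2 + 1
              else (int m + 1) * int d - (int m)\<^sup>2)"
proof -
  interpret vs: vector_space s by fact
  obtain B where B: "B \<subseteq> UNIV" "vs.independent B" "UNIV \<subseteq> vs.span B" "card B = vs.dim UNIV"
    by (rule vs.basis_exists)
  have "finite B" using B(4) assms(3,7) by (intro card_ge_0_finite) simp
  then interpret finite_vector_space s B
    by unfold_locales (use B in auto)
  have d: "dimension = d" using B(4) assms(7) by (simp add: dimension_def)
  have m: "1 \<le> m" "m < dimension" using assms d by auto
  let ?K = "{xs. irredundant_base (PGL s) (subspaces_of_dim s m) (PGL_action s m) xs}"
  have upper: "int n \<le> (int m + 1) * int d - 2 * int m + 1" if "n \<in> length ` ?K" for n
    using that irredundant_chain_length_le[OF _ _ m(1)] assms(3)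
    by (auto simp: irredundant_base_iff is_base_def d)
  have "n \<le> nat ((int m + 1) * int d - 2 * int m + 1)" if "n \<in> length ` ?K" for n
    using upper[OF that] by linarith
  then have "length ` ?K \<subseteq> {..nat ((int m + 1) * int d - 2 * int m + 1)}" by blast
  then have fin: "finite (length ` ?K)" by (rule finite_subset) simp
  obtain xs where xs: "xs \<in> ?K"
    "m * (d - m) + (if q = 2 then 1 else d) \<le> length xs"
    using exists_long_irredundant_base[OF m] d assms(2) by auto
  have in_K: "max_irredundant (PGL s) (subspaces_of_dim s m) (PGL_action s m) \<in> length ` ?K"
    unfolding max_irredundant_def using fin xs(1) by (intro Max_in) auto
  have int_diff: "int (d - m) = int d - int m" using m d by simp
  have "length xs \<le> max_irredundant (PGL s) (subspaces_of_dim s m) (PGL_action s m)"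
    unfolding max_irredundant_def using fin xs(1) by (intro Max_ge) auto
  then have "int (m * (d - m)) + (if q = 2 then 1 else int d)
      \<le> int (max_irredundant (PGL s) (subspaces_of_dim s m) (PGL_action s m))"
    using xs(2) by (cases "q = 2") (simp_all del: of_nat_mult flip: of_nat_add of_nat_Suc)
  also have "int (m * (d - m)) = int m * int d - (int m)\<^sup>2"
    by (simp only: of_nat_mult int_diff) (simp add: algebra_simps power2_eq_square)
  finally have "(if q = 2 then int m * int d - (int m)\<^sup>2 + 1 else (int m + 1) * int d - (int m)\<^sup>2)
      \<le> int (max_irredundant (PGL s) (subspaces_of_dim s m) (PGL_action s m))"
    by (simp add: algebra_simps split: if_splits)
  with upper in_K show ?thesis by blast
qed

end
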